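(* Consider the Kernelized Nonlinear Regulator (KNR) model $M$ with feature dimension $d_\phi$ and noise level $\sigma$. Let $\mathcal F_h=\mathcal G_h=\{U\in\mathbb R^{d_s\times d_\phi}:\|U\|_2\le R\}$ and $\ell_{h,f'}(\zeta_h,\eta_h,f,g)=U_{h,g}\phi(s_h,a_h)-s_{h+1}$, with $\zeta_h=\{s_{h+1}\}$, $\eta_h=\{s_h,a_h\}$. Then $(M,\mathcal F,\mathcal G,\ell,d,\kappa)$ is an $\ell_2$-type EC class with $d=\widetilde{\mathcal O}(d_\phi)$ and $\kappa=2H/\sigma$. Indeed, for every $h\in[H]$ and $\beta\ge R^2$: if $$\sum_{i=1}^{k-1}\|(U_{h,f^k}-U_h^* )\phi(s_h^i,a_h^i)\|_2^2\le\beta\qquad\text{for all }k\in[K],$$ then $$\sum_{i=1}^k\|(U_{h,f^i}-U_h^* )\phi(s_h^i,a_h^i)\|_2^2\le\mathcal O(d\beta\log K)\qquad\text{for all }k\in[K].$$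
   Context: **KNR model.** Episodic MDP with horizon $H$, state space in $\mathbb R^{d_s}$, total reward in $[0,1]$ along every trajectory, and dynamics $s_{h+1}=U_h^*\phi(s_h,a_h)+\varepsilon_{h+1}$, where $\phi:\mathcal S\times\mathcal A\to\mathbb R^{d_\phi}$ is a known feature map with $\|\phi\|_2\le1$, $U_h^*\in\mathbb R^{d_s\times d_\phi}$ is unknown with $\|U_h^*\|_2\le R$, and $\varepsilon_{h+1}\sim\mathcal N(0,\sigma^2I)$. A hypothesis $f=\{U_{h,f}\}_{h\in[H]}$ represents the model with dynamics matrices $U_{h,f}$; $V_{h,f}$ and $\pi_f$ are its optimal value function and policy. $\mathbb E_{\zeta_h}$ is expectation over $s_{h+1}$ given $(s_h,a_h)$ under the true model, so $\mathbb E_{\zeta_h}[\ell_{h,f'}(\zeta_h,\eta_h,f,g)]=(U_{h,g}-U_h^* )\phi(s_h,a_h)$. **$\ell_2$-type EC class.** $(M,\mathcal F,\mathcal G,\ell,d,\kappa)$ ($\mathcal F\subset\mathcal G$ containing the true hypothesis, $\ell$ bounded) is an $\ell_2$-type EC class if for every $\beta\ge R^2$ and $h\in[H]$: (i) for any $f^1,\dots,f^K\in\mathcal F$ and $\eta_h^1,\dots,\eta_h^K$, if $\sum_{i=1}^{k-1}\|\mathbb E_{\zeta_h}[\ell_{h,f^i}(\zeta_h,\eta_h^i,f^k,f^k)]\|_2^2\le\beta$ for all $k\in[K]$, then $\sum_{i=1}^k\|\mathbb E_{\zeta_h}[\ell_{h,f^i}(\zeta_h,\eta_h^i,f^i,f^i)]\|_2^2\le\mathcal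 O(d\beta\log k)$ for all $k\in[K]$ (here understood with $\log K$ on the right-hand side); (ii) ($\kappa$-dominance) for any $k\in[K]$, with probability at least $1-\delta$, $\sum_{i=1}^k(V_{1,f^i}(s_1)-V_1^{\pi^i}(s_1))\le\kappa\sum_{h=1}^H\sum_{i=1}^k\mathbb E_{\eta_h\sim\pi^i}\|\mathbb E_{\zeta_h}[\ell_{h,f^i}(\zeta_h,\eta_h,f^i,f^i)]\|_2$ with $\pi^i=\pi_{f^i}$. In this example the boundedness requirement on $\ell$ is understood in the high-probability sense (the Gaussian noise is $\widetilde{\mathcal O}(\sigma)$ with high probability). $\mathcal O$ hides absolute constants and dependence on $R$ (terms independent of $k$); $\widetilde{\mathcal O}$ hides logarithmic factors. *)

theory Defs
  imports "HOL-Probability.Probability"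
begin

section \<open>Episodic Markov decision processes\<close>

text \<open>
  The state space is all of the type \<^typ>\<open>'s\<close> with its Borel sets. Actions live in an
  arbitrary measurable space. Steps are numbered \<open>1, \<dots>, horizon M\<close>.
\<close>

record ('s, 'a) mdp =
  horizon :: nat
  actions :: "'a measure"
  initial_state :: 's
  transition :: "nat \<Rightarrow> 's \<times> 'a \<Rightarrow> 's measure"
  reward :: "nat \<Rightarrow> 's \<times> 'a \<Rightarrow> real"

type_synonym ('s, 'a) policy = "nat \<Rightarrow> 's \<Rightarrow> 'a"

definition policies :: "('s::topological_space, 'a) mdp \<Rightarrow> ('s, 'a) policy set" where
  "policies M = {\<pi>. \<forall>h\<in>{1..horizon M}. \<pi> h \<in> borel \<rightarrow>\<^sub>M actions M}"

definition state_actions :: "('s, 'a) mdp \<Rightarrow> ('s \<times> 'a) set" where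
  "state_actions M = UNIV \<times> space (actions M)"

definition unit_total_reward :: "('s, 'a) mdp \<Rightarrow> bool" where
  "unit_total_reward M \<longleftrightarrow>
     (\<forall>\<eta>. (\<forall>h\<in>{1..horizon M}. \<eta> h \<in> state_actions M) \<longrightarrow>
        (\<Sum>h=1..horizon M. reward M h (\<eta> h)) \<in> {0..1})"

text \<open>
  Law of the states visited when \<open>\<pi>\<close> is run for \<open>n\<close> transitions starting from state \<open>s\<close> at
  step \<open>h\<close>. A sample point \<open>w\<close> carries the state of step \<open>j\<close> at index \<open>j\<close>, for
  \<open>h \<le> j \<le> h + n\<close>; its remaining entries are the dummy value \<open>s\<close>.
\<close>

primrec path_law ::
  "('s::topological_space, 'a) mdp \<Rightarrow> ('s, 'a) policy \<Rightarrow> nat \<Rightarrow> 's \<Rightarrow> nat \<Rightarrow> (nat \<Rightarrow> 's) measure"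
where
  "path_law M \<pi> h s 0 = return (Pi\<^sub>M UNIV (\<lambda>_. borel)) (\<lambda>_. s)"
| "path_law M \<pi> h s (Suc n) =
     path_law M \<pi> h s n \<bind>
       (\<lambda>w. distr (transition M (h + n) (w (h + n), \<pi> (h + n) (w (h + n))))
               (Pi\<^sub>M UNIV (\<lambda>_. borel)) (\<lambda>s'. w(Suc (h + n) := s')))"

definition policy_value ::
  "('s::topological_space, 'a) mdp \<Rightarrow> ('s, 'a) policy \<Rightarrow> nat \<Rightarrow> 's \<Rightarrow> real" where
  "policy_value M \<pi> h s =
     (\<integral>w. (\<Sum>j=h..horizon M. reward M j (w j, \<pi> j (w j))) \<partial>path_law M \<pi> h s (horizon M - h))"

definition optimal_value :: "('s::topological_space, 'a) mdp \<Rightarrow> nat \<Rightarrow> 's \<Rightarrow> real" where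
  "optimal_value M h s = (SUP \<pi>\<in>policies M. policy_value M \<pi> h s)"

definition optimal_policy :: "('s::topological_space, 'a) mdp \<Rightarrow> ('s, 'a) policy \<Rightarrow> bool" where
  "optimal_policy M \<pi> \<longleftrightarrow>
     \<pi> \<in> policies M \<and>
     (\<forall>h\<in>{1..horizon M}. \<forall>s. policy_value M \<pi> h s = optimal_value M h s)"

text \<open>The law of \<open>\<eta>\<^sub>h = (s\<^sub>h, a\<^sub>h)\<close> when \<open>\<pi>\<close> is run from the initial state.\<close>

definition occupancy ::
  "('s::topological_space, 'a) mdp \<Rightarrow> ('s, 'a) policy \<Rightarrow> nat \<Rightarrow> ('s \<times> 'a) measure" where
  "occupancy M \<pi> h =
     distr (path_law M \<pi> 1 (initial_state M) (h - 1)) (borel \<Otimes>\<^sub>M actions M) (\<lambda>w. (w h, \<pi> h (w h)))"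


section \<open>The \<open>\<ell>\<^sub>2\<close>-type EC class\<close>

text \<open>
  A loss is applied as \<open>l h f' \<zeta> \<eta> f g\<close>, with \<open>\<zeta> = s\<^sub>h\<^sub>+\<^sub>1\<close> and \<open>\<eta> = (s\<^sub>h, a\<^sub>h)\<close>.
\<close>

type_synonym ('s, 'a, 'f, 'v) loss =
  "nat \<Rightarrow> 'f \<Rightarrow> 's \<Rightarrow> 's \<times> 'a \<Rightarrow> 'f \<Rightarrow> 'f \<Rightarrow> 'v"

definition expected_loss ::
  "('s, 'a) mdp \<Rightarrow> ('s, 'a, 'f, 'v::euclidean_space) loss \<Rightarrow>
     nat \<Rightarrow> 'f \<Rightarrow> 's \<times> 'a \<Rightarrow> 'f \<Rightarrow> 'f \<Rightarrow> 'v" where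
  "expected_loss M l h f' \<eta> f g = (\<integral>\<zeta>. l h f' \<zeta> \<eta> f g \<partial>transition M h \<eta>)"

definition true_hypothesis ::
  "('s::topological_space, 'a) mdp \<Rightarrow> ('f \<Rightarrow> nat \<Rightarrow> 's \<Rightarrow> real) \<Rightarrow> ('f \<Rightarrow> ('s, 'a) policy) \<Rightarrow> 'f \<Rightarrow> bool"
where
  "true_hypothesis M V \<pi> f \<longleftrightarrow>
     (\<forall>h\<in>{1..horizon M}. \<forall>s. V f h s = optimal_value M h s) \<and> optimal_policy M (\<pi> f)"

definition bounded_whp ::
  "('s::topological_space, 'a) mdp \<Rightarrow> 'f set \<Rightarrow> 'f set \<Rightarrow> ('s, 'a, 'f, 'v::euclidean_space) loss \<Rightarrow>
     (real \<Rightarrow> real) \<Rightarrow> bool" where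
  "bounded_whp M F G l L \<longleftrightarrow>
     (\<forall>\<delta>\<in>{0<..<1}. \<forall>h\<in>{1..horizon M}. \<forall>f'\<in>F. \<forall>f\<in>F. \<forall>g\<in>G. \<forall>\<eta>\<in>state_actions M.
        measure (transition M h \<eta>) {\<zeta> \<in> space (transition M h \<eta>). norm (l h f' \<zeta> \<eta> f g) \<le> L \<delta>}
          \<ge> 1 - \<delta>)"

text \<open>
  The constant hidden by \<open>\<O>(d \<beta> log K)\<close> is the explicit argument \<open>c\<close>. The bound is stated for
  \<open>K \<ge> 2\<close>, because \<open>log K\<close> vanishes at \<open>K = 1\<close>.
\<close>

definition eluder_condition ::
  "real \<Rightarrow> real \<Rightarrow> ('s, 'a) mdp \<Rightarrow> 'f set \<Rightarrow> ('s, 'a, 'f, 'v::euclidean_space) loss \<Rightarrow> real \<Rightarrow> bool"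
where
  "eluder_condition c \<beta>\<^sub>0 M F l d \<longleftrightarrow>
     (\<forall>\<beta>\<ge>\<beta>\<^sub>0. \<forall>h\<in>{1..horizon M}. \<forall>K\<ge>2. \<forall>f \<eta>.
        (\<forall>i\<in>{1..K}. f i \<in> F) \<longrightarrow> (\<forall>i\<in>{1..K}. \<eta> i \<in> state_actions M) \<longrightarrow>
        (\<forall>k\<in>{1..K}.
           (\<Sum>i\<in>{1..<k}. (norm (expected_loss M l h (f i) (\<eta> i) (f k) (f k)))\<^sup>2) \<le> \<beta>) \<longrightarrow>
        (\<forall>k\<in>{1..K}.
           (\<Sum>i\<in>{1..k}. (norm (expected_loss M l h (f i) (\<eta> i) (f i) (f i)))\<^sup>2)
             \<le> c * (d * \<beta> * ln (real K))))"

text \<open>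
  The probability in the dominance condition is over the choice of the hypotheses
  \<open>f\<^sup>1, \<dots>, f\<^sup>K\<close>, which a learner may draw at random; \<open>P\<close> ranges over all joint laws
  (point masses included) of such sequences.
\<close>

definition dominance ::
  "('s::topological_space, 'a) mdp \<Rightarrow> 'f set \<Rightarrow> ('f \<Rightarrow> nat \<Rightarrow> 's \<Rightarrow> real) \<Rightarrow> ('f \<Rightarrow> ('s, 'a) policy) \<Rightarrow>
     ('s, 'a, 'f, 'v::euclidean_space) loss \<Rightarrow> real \<Rightarrow> bool" where
  "dominance M F V \<pi> l \<kappa> \<longleftrightarrow>
     (\<forall>K. \<forall>P :: (nat \<Rightarrow> 'f) measure.
        prob_space P \<longrightarrow> (\<forall>f\<in>space P. \<forall>i\<in>{1..K}. f i \<in> F) \<longrightarrow>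
        (\<forall>k\<in>{1..K}. \<forall>\<delta>\<in>{0<..<1}. \<exists>E\<in>sets P. measure P E \<ge> 1 - \<delta> \<and>
           (\<forall>f\<in>E.
              (\<Sum>i=1..k. V (f i) 1 (initial_state M) - policy_value M (\<pi> (f i)) 1 (initial_state M))
              \<le> \<kappa> * (\<Sum>h=1..horizon M. \<Sum>i=1..k.
                   \<integral>\<eta>. norm (expected_loss M l h (f i) \<eta> (f i) (f i)) \<partial>occupancy M (\<pi> (f i)) h))))"

text \<open>
  \<open>V f\<close> and \<open>\<pi> f\<close> are the value function and the policy attached to the hypothesis \<open>f\<close>;
  \<open>fs\<close> is the true hypothesis, \<open>\<beta>\<^sub>0\<close> the smallest admissible \<open>\<beta>\<close> and \<open>L \<delta>\<close> the bound that the
  loss obeys with probability at least \<open>1 - \<delta>\<close>.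
\<close>

definition l2_type_EC_class ::
  "real \<Rightarrow> real \<Rightarrow> (real \<Rightarrow> real) \<Rightarrow> ('f \<Rightarrow> nat \<Rightarrow> 's \<Rightarrow> real) \<Rightarrow> ('f \<Rightarrow> ('s, 'a) policy) \<Rightarrow> 'f \<Rightarrow>
     ('s::topological_space, 'a) mdp \<Rightarrow> 'f set \<Rightarrow> 'f set \<Rightarrow>
     ('s, 'a, 'f, 'v::euclidean_space) loss \<Rightarrow> real \<Rightarrow> real \<Rightarrow> bool" where
  "l2_type_EC_class c \<beta>\<^sub>0 L V \<pi> fs M F G l d \<kappa> \<longleftrightarrow>
     F \<subseteq> G \<and> fs \<in> F \<and> true_hypothesis M V \<pi> fs \<and>
     bounded_whp M F G l L \<and>
     eluder_condition c \<beta>\<^sub>0 M F l d \<and>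
     dominance M F V \<pi> l \<kappa>"


section \<open>The Kernelized Nonlinear Regulator\<close>

text \<open>The distribution \<open>\<N>(0, \<sigma>\<^sup>2 I)\<close>.\<close>

definition gaussian_noise :: "real \<Rightarrow> (real ^ 's) measure" where
  "gaussian_noise \<sigma> = density lborel (\<lambda>x. ennreal (\<Prod>i\<in>UNIV. normal_density 0 \<sigma> (x $ i)))"

text \<open>
  \<open>\<parallel>U\<parallel>\<^sub>2\<close> of a matrix is the operator norm; \<^const>\<open>norm\<close> on this type would be the Frobenius norm.
\<close>

definition spectral_norm :: "real ^ 'n ^ 's \<Rightarrow> real" where
  "spectral_norm U = onorm ((*v) U)"

definition knr_mdp ::
  "nat \<Rightarrow> 'a measure \<Rightarrow> real ^ 's \<Rightarrow> (nat \<Rightarrow> (real ^ 's) \<times> 'a \<Rightarrow> real) \<Rightarrow>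
     ((real ^ 's) \<times> 'a \<Rightarrow> real ^ 'n) \<Rightarrow> real \<Rightarrow> (nat \<Rightarrow> real ^ 'n ^ 's) \<Rightarrow> (real ^ 's, 'a) mdp" where
  "knr_mdp H A s\<^sub>1 r \<phi> \<sigma> U =
     \<lparr> horizon = H, actions = A, initial_state = s\<^sub>1,
       transition = (\<lambda>h \<eta>. distr (gaussian_noise \<sigma>) borel (\<lambda>\<epsilon>. U h *v \<phi> \<eta> + \<epsilon>)),
       reward = r \<rparr>"

definition knr_hypotheses :: "nat \<Rightarrow> real \<Rightarrow> (nat \<Rightarrow> real ^ 'n ^ 's) set" where
  "knr_hypotheses H R = {f. \<forall>h\<in>{1..H}. spectral_norm (f h) \<le> R}"

definition knr_loss ::
  "((real ^ 's) \<times> 'a \<Rightarrow> real ^ 'n) \<Rightarrow> (real ^ 's, 'a, nat \<Rightarrow> real ^ 'n ^ 's, real ^ 's) loss" where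
  "knr_loss \<phi> h f' \<zeta> \<eta> f g = g h *v \<phi> \<eta> - \<zeta>"

end

theory Submission
  imports Defs
begin

text \<open>
  The eluder bound is the elliptical potential argument: the regularised Gram matrix
  \<open>\<Lambda>\<^sub>k = I + \<Sum>\<^sub>i\<^sub><\<^sub>k \<phi>\<^sub>i \<phi>\<^sub>i\<^sup>T\<close> satisfies \<open>\<parallel>(U\<^sub>k - U\<^sup>*) \<phi>\<^sub>k\<parallel>\<^sup>2 \<le> 5 \<beta> \<phi>\<^sub>k\<^sup>T \<Lambda>\<^sub>k\<^sup>-\<^sup>1 \<phi>\<^sub>k\<close>, its determinant
  grows by the factor \<open>1 + \<phi>\<^sub>k\<^sup>T \<Lambda>\<^sub>k\<^sup>-\<^sup>1 \<phi>\<^sub>k\<close> at each step, and that determinant never exceeds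
  \<open>(1 + K)\<^sup>d\<close>. Dominance holds surely: the value of \<open>\<pi>\<^sub>f\<close> changes between the model \<open>f\<close> and the true
  model by at most the sum over the steps of the total variation distances between two Gaussians
  with means \<open>U\<^sub>f \<phi>\<close> and \<open>U\<^sup>* \<phi>\<close>, each at most \<open>2 \<parallel>(U\<^sub>f - U\<^sup>*) \<phi>\<parallel> / \<sigma>\<close>.
\<close>

section \<open>The elliptical potential\<close>

lemma abs_det_le_fact_mult_power:
  fixes A :: "real ^ 'n ^ 'n"
  assumes "\<And>i j. \<bar>A $ i $ j\<bar> \<le> B"
  shows "\<bar>det A\<bar> \<le> fact CARD('n) * B ^ CARD('n)"
proof -
  have "\<bar>det A\<bar> \<le> (\<Sum>p | p permutes (UNIV::'n set). \<bar>of_int (sign p) * (\<Prod>i\<in>UNIV. A $ i $ p i)\<bar>)"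
    unfolding det_def by (rule sum_abs)
  also have "\<dots> \<le> (\<Sum>p | p permutes (UNIV::'n set). B ^ CARD('n))"
  proof (rule sum_mono)
    fix p :: "'n \<Rightarrow> 'n"
    have "\<bar>of_int (sign p) * (\<Prod>i\<in>UNIV. A $ i $ p i)\<bar> = (\<Prod>i\<in>UNIV. \<bar>A $ i $ p i\<bar>)"
      by (simp add: abs_mult abs_prod sign_def)
    also have "\<dots> \<le> (\<Prod>i\<in>(UNIV::'n set). B)"
      by (rule prod_mono) (simp add: assms)
    finally show "\<bar>of_int (sign p) * (\<Prod>i\<in>UNIV. A $ i $ p i)\<bar> \<le> B ^ CARD('n)"
      by simp
  qed
  also have "\<dots> = fact CARD('n) * B ^ CARD('n)"
    by (simp add: card_permutations)
  finally show ?thesis .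
qed

text \<open>
  The factor \<open>n!\<close> of the Leibniz bound disappears by applying that bound to the powers of \<open>A\<close> and
  taking roots.
\<close>

lemma abs_det_le_power:
  fixes A :: "real ^ 'n ^ 'n"
  assumes B: "\<And>x. norm (A *v x) \<le> B * norm x" and "B > 0"
  shows "\<bar>det A\<bar> \<le> B ^ CARD('n)"
proof (rule ccontr)
  let ?q = "\<bar>det A\<bar> / B ^ CARD('n)"
  assume "\<not> ?thesis"
  with \<open>B > 0\<close> have "?q > 1" by (simp add: field_simps)
  then obtain m where m: "?q ^ m > fact CARD('n)"
    using real_arch_pow by blast
  have "\<exists>P :: real ^ 'n ^ 'n. det P = det A ^ m \<and> (\<forall>x. norm (P *v x) \<le> B ^ m * norm x)" for m
  proof (induction m)
    case 0
    show ?case by (intro exI[of _ "mat 1"]) simp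
  next
    case (Suc m)
    then obtain P :: "real ^ 'n ^ 'n"
      where P: "det P = det A ^ m" "\<And>x. norm (P *v x) \<le> B ^ m * norm x" by blast
    have "norm ((A ** P) *v x) \<le> B ^ Suc m * norm x" for x
    proof -
      have "norm (A *v (P *v x)) \<le> B * norm (P *v x)" by (rule B)
      also have "\<dots> \<le> B * (B ^ m * norm x)" using P(2) \<open>B > 0\<close> by simp
      finally show ?thesis by (simp add: matrix_vector_mul_assoc mult.assoc)
    qed
    with P(1) show ?case by (intro exI[of _ "A ** P"]) (simp add: det_mul)
  qed
  then obtain P :: "real ^ 'n ^ 'n"
    where P: "det P = det A ^ m" "\<And>x. norm (P *v x) \<le> B ^ m * norm x" by blast
  have "\<bar>P $ i $ j\<bar> \<le> B ^ m" for i j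
  proof -
    have "P $ i $ j = (P *v axis j 1) $ i"
      by (simp add: matrix_vector_mult_basis column_def)
    also have "\<bar>\<dots>\<bar> \<le> norm (P *v axis j 1)" by (rule component_le_norm_cart)
    also have "\<dots> \<le> B ^ m" using P(2)[of "axis j 1"] by simp
    finally show ?thesis .
  qed
  then have "\<bar>det A\<bar> ^ m \<le> fact CARD('n) * (B ^ m) ^ CARD('n)"
    using abs_det_le_fact_mult_power[of P "B ^ m"] by (simp add: P(1) power_abs)
  then have "?q ^ m \<le> fact CARD('n)"
    using \<open>B > 0\<close> by (simp add: power_divide field_simps flip: power_mult)
  with m show False by simp
qed

definition outer :: "real ^ 'm \<Rightarrow> real ^ 'n \<Rightarrow> real ^ 'n ^ 'm" where
  "outer y x = (\<chi> i j. y $ i * x $ j)"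

lemma outer_mult_vec: "outer y x *v v = (x \<bullet> v) *\<^sub>R y"
  by (simp add: outer_def matrix_vector_mult_def inner_vec_def vec_eq_iff sum_distrib_left
      sum_distrib_right mult_ac)

lemma det_mat_1_plus_outer_axis:
  fixes y :: "real ^ 'n"
  shows "det (mat 1 + outer y (axis k c)) = 1 + c * y $ k"
proof -
  have "mat 1 + outer y (axis k c) =
    (\<chi> i j. if j = k then (mat 1 *v (axis k 1 + c *\<^sub>R y)) $ i else mat 1 $ i $ j)"
    unfolding matrix_vector_mul_lid by (auto simp: vec_eq_iff outer_def axis_def mat_def)
  also have "det \<dots> = (axis k 1 + c *\<^sub>R y) $ k * det (mat 1 :: real ^ 'n ^ 'n)"
    by (rule cramer_lemma)
  finally show ?thesis by simp
qed

lemma det_mat_1_plus_outer: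
  fixes x y :: "real ^ 'n"
  shows "det (mat 1 + outer y x) = 1 + x \<bullet> y"
proof -
  fix k :: 'n
  have "norm x = norm (axis k (norm x))"
    by (simp add: norm_eq_sqrt_inner[of "axis k _"] inner_axis_axis)
  then obtain f where f: "orthogonal_transformation f" "f x = axis k (norm x)"
    by (rule orthogonal_transformation_exists)
  define Q where "Q = matrix f"
  have lf: "linear f" and Q: "orthogonal_matrix Q"
    using f(1) by (auto simp: orthogonal_transformation_matrix Q_def)
  have Qv: "Q *v v = f v" for v
    unfolding Q_def using lf by (simp add: matrix_vector_mul(1))
  have inv: "transpose Q ** Q = mat 1" "Q ** transpose Q = mat 1"
    using Q by (auto simp: orthogonal_matrix_def)
  have "(Q ** (mat 1 + outer y x) ** transpose Q) *v v
      = (mat 1 + outer (f y) (axis k (norm x))) *v v" for v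
  proof -
    have fT: "f (transpose Q *v v) = v"
      unfolding Qv[symmetric] matrix_vector_mul_assoc inv(2) by simp
    have "x \<bullet> (transpose Q *v v) = f x \<bullet> v"
      using f(1) fT by (metis orthogonal_transformation_def)
    then show ?thesis
      using lf fT by (simp flip: matrix_vector_mul_assoc del: transpose_matrix_vector
        add: matrix_vector_mult_add_rdistrib outer_mult_vec Qv linear_add linear_scale f(2))
  qed
  then have "Q ** (mat 1 + outer y x) ** transpose Q = mat 1 + outer (f y) (axis k (norm x))"
    by (simp add: matrix_eq)
  then have "det (mat 1 + outer y x) * (det Q * det (transpose Q)) = 1 + norm x * f y $ k"
    by (metis det_mat_1_plus_outer_axis det_mul mult.commute mult.left_commute)
  also have "det Q * det (transpose Q) = 1"
    using inv(2) by (metis det_I det_mul)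
  also have "norm x * f y $ k = f x \<bullet> f y"
    by (simp add: f(2) inner_axis')
  also have "\<dots> = x \<bullet> y"
    using f(1) by (simp add: orthogonal_transformation_def)
  finally show ?thesis by simp
qed

lemma ln_1_plus_ge_half:
  fixes w :: real
  assumes "0 \<le> w" "w \<le> 1"
  shows "w / 2 \<le> ln (1 + w)"
proof -
  have "w / 2 \<le> w / (1 + w)"
    using assms by (intro divide_left_mono) auto
  also have "\<dots> = 1 - 1 / (1 + w)"
    using assms by (simp add: field_simps)
  also have "\<dots> \<le> - ln (1 / (1 + w))"
    using ln_le_minus_one[of "1 / (1 + w)"] assms by simp
  also have "\<dots> = ln (1 + w)"
    using assms by (simp add: ln_div)
  finally show ?thesis .
qed

definition gram :: "(nat \<Rightarrow> real ^ 'n) \<Rightarrow> nat \<Rightarrow> real ^ 'n ^ 'n" where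
  "gram x k = mat 1 + (\<Sum>i\<in>{1..<k}. outer (x i) (x i))"

lemma gram_Suc: "k \<ge> 1 \<Longrightarrow> gram x (Suc k) = gram x k + outer (x k) (x k)"
  by (simp add: gram_def atLeastLessThanSuc algebra_simps)

lemma sum_matrix_vector_mult: "(\<Sum>i\<in>I. A i) *v v = (\<Sum>i\<in>I. A i *v (v :: real ^ 'n))"
  by (induction I rule: infinite_finite_induct) (simp_all add: matrix_vector_mult_add_rdistrib)

lemma gram_mult_vec: "gram x k *v v = v + (\<Sum>i\<in>{1..<k}. (x i \<bullet> v) *\<^sub>R x i)"
  by (simp add: gram_def matrix_vector_mult_add_rdistrib sum_matrix_vector_mult outer_mult_vec)

lemma inner_gram:
  "u \<bullet> (gram x k *v v) = u \<bullet> v + (\<Sum>i\<in>{1..<k}. (u \<bullet> x i) * (v \<bullet> x i))"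
  by (simp add: gram_mult_vec inner_add_right inner_sum_right inner_commute mult.commute)

lemma gram_inner_self_ge: "(norm v)\<^sup>2 \<le> v \<bullet> (gram x k *v v)"
  by (simp add: inner_gram power2_norm_eq_inner sum_nonneg)

lemma gram_Cauchy_Schwarz:
  "(u \<bullet> (gram x k *v v))\<^sup>2 \<le> (u \<bullet> (gram x k *v u)) * (v \<bullet> (gram x k *v v))"
proof -
  have "0 \<le> (u \<bullet> (gram x k *v u)) * t\<^sup>2 + 2 * (u \<bullet> (gram x k *v v)) * t + (v \<bullet> (gram x k *v v))" for t
  proof -
    have "v \<bullet> (gram x k *v u) = u \<bullet> (gram x k *v v)"
      by (simp add: inner_gram inner_commute mult.commute)
    then have "(t *\<^sub>R u + v) \<bullet> (gram x k *v (t *\<^sub>R u + v))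
      = (u \<bullet> (gram x k *v u)) * t\<^sup>2 + 2 * (u \<bullet> (gram x k *v v)) * t + (v \<bullet> (gram x k *v v))"
      by (simp add: matrix_vector_mult_scaleR matrix_vector_right_distrib algebra_simps power2_eq_square
          inner_commute)
    then show ?thesis
      using gram_inner_self_ge[of "t *\<^sub>R u + v" x k] by (metis order_trans zero_le_power2)
  qed
  note q = this
  let ?a = "u \<bullet> (gram x k *v u)" and ?b = "u \<bullet> (gram x k *v v)" and ?c = "v \<bullet> (gram x k *v v)"
  show ?thesis
  proof (cases "?a = 0")
    case True
    then have "u = 0"
      using gram_inner_self_ge[of u x k] by simp
    then show ?thesis by simp
  next
    case False
    then have "?a > 0"
      using gram_inner_self_ge[of u x k] zero_le_power2[of "norm u"] by linarith
    then show ?thesis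
      using q[of "- ?b / ?a"] by (simp add: field_simps power2_eq_square)
  qed
qed

lemma gram_solve:
  obtains y where "gram x k *v y = v"
proof -
  have "inj ((*v) (gram x k))"
  proof (rule injI)
    fix a b assume "gram x k *v a = gram x k *v b"
    then have "gram x k *v (a - b) = 0" by (simp add: matrix_vector_mult_diff_distrib)
    then show "a = b" using gram_inner_self_ge[of "a - b" x k] by simp
  qed
  then have "surj ((*v) (gram x k))"
    by (simp add: linear_injective_imp_surjective)
  then show thesis using that by (metis surjD)
qed

lemma norm_gram_mult_le:
  assumes "\<And>i. i \<in> {1..<k} \<Longrightarrow> norm (x i) \<le> 1" "k \<ge> 1"
  shows "norm (gram x k *v v) \<le> real k * norm v"
proof -
  have "norm (gram x k *v v) \<le> norm v + (\<Sum>i\<in>{1..<k}. norm ((x i \<bullet> v) *\<^sub>R x i))"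
    unfolding gram_mult_vec by (intro norm_triangle_le add_left_mono norm_sum)
  also have "(\<Sum>i\<in>{1..<k}. norm ((x i \<bullet> v) *\<^sub>R x i)) \<le> (\<Sum>i\<in>{1..<k}. norm v)"
  proof (rule sum_mono)
    fix i assume i: "i \<in> {1..<k}"
    have "norm ((x i \<bullet> v) *\<^sub>R x i) \<le> (norm (x i) * norm v) * norm (x i)"
      by (simp add: Cauchy_Schwarz_ineq2 mult_right_mono)
    also have "\<dots> \<le> (1 * norm v) * 1"
      using assms(1)[OF i] by (intro mult_mono) auto
    finally show "norm ((x i \<bullet> v) *\<^sub>R x i) \<le> norm v" by simp
  qed
  finally show ?thesis using assms(2) by (simp add: of_nat_diff algebra_simps)
qed

lemma elliptical_potential:
  fixes x y :: "nat \<Rightarrow> real ^ 'n"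
  assumes x: "\<And>i. i \<in> {1..K} \<Longrightarrow> norm (x i) \<le> 1"
    and y: "\<And>i. i \<in> {1..K} \<Longrightarrow> gram x i *v y i = x i"
  shows "(\<Sum>i\<in>{1..K}. x i \<bullet> y i) \<le> 2 * real CARD('n) * ln (1 + real K)"
proof -
  have w: "0 \<le> x i \<bullet> y i \<and> x i \<bullet> y i \<le> 1" if i: "i \<in> {1..K}" for i
  proof -
    have sq: "(norm (y i))\<^sup>2 \<le> x i \<bullet> y i"
      using gram_inner_self_ge[of "y i" x i] y[OF i] by (simp add: inner_commute)
    have "x i \<bullet> y i \<le> norm (x i) * norm (y i)" by (rule norm_cauchy_schwarz)
    also have "\<dots> \<le> norm (y i)" using x[OF i] by (simp add: mult_left_le_one_le)
    finally have le: "x i \<bullet> y i \<le> norm (y i)" .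
    with sq have "norm (y i) * norm (y i) \<le> 1 * norm (y i)" by (simp add: power2_eq_square)
    then have "norm (y i) \<le> 1"
      by (cases "norm (y i) = 0") (auto simp: mult_le_cancel_right)
    with le sq show ?thesis by (smt (verit) zero_le_power2)
  qed
  have det: "k \<le> K \<Longrightarrow> det (gram x (Suc k)) = (\<Prod>i\<in>{1..k}. 1 + x i \<bullet> y i)" for k
  proof (induction k)
    case 0
    then show ?case by (simp add: gram_def)
  next
    case (Suc k)
    let ?k = "Suc k"
    have "gram x (Suc ?k) *v v = (gram x ?k ** (mat 1 + outer (y ?k) (x ?k))) *v v" for v
      using y[of ?k] Suc.prems
      by (simp flip: matrix_vector_mul_assoc add: gram_Suc matrix_vector_mult_add_rdistrib
          outer_mult_vec matrix_vector_right_distrib matrix_vector_mult_scaleR)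
    then have "gram x (Suc ?k) = gram x ?k ** (mat 1 + outer (y ?k) (x ?k))"
      by (simp add: matrix_eq)
    then have "det (gram x (Suc ?k)) = det (gram x ?k) * (1 + x ?k \<bullet> y ?k)"
      by (simp add: det_mul det_mat_1_plus_outer)
    with Suc show ?case by simp
  qed
  have pos: "1 + x i \<bullet> y i > 0" if "i \<in> {1..K}" for i
    using w[OF that] by linarith
  have "(\<Sum>i\<in>{1..K}. x i \<bullet> y i) \<le> (\<Sum>i\<in>{1..K}. 2 * ln (1 + x i \<bullet> y i))"
    using w ln_1_plus_ge_half by (intro sum_mono) fastforce
  also have "\<dots> = 2 * ln (\<Prod>i\<in>{1..K}. 1 + x i \<bullet> y i)"
    by (subst ln_prod) (use pos in \<open>fastforce simp: sum_distrib_left\<close>)+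
  also have "(\<Prod>i\<in>{1..K}. 1 + x i \<bullet> y i) = det (gram x (Suc K))"
    using det[of K] by simp
  also have "ln \<dots> \<le> ln ((1 + real K) ^ CARD('n))"
  proof (rule ln_mono)
    show "0 < det (gram x (Suc K))"
      unfolding det[OF order_refl] using pos by (rule prod_pos)
    have "norm (gram x (Suc K) *v v) \<le> (1 + real K) * norm v" for v
      using norm_gram_mult_le[of "Suc K" x v] x by (simp add: add.commute)
    from abs_det_le_power[OF this] show "det (gram x (Suc K)) \<le> (1 + real K) ^ CARD('n)"
      by linarith
  qed
  finally show ?thesis by (simp add: ln_realpow mult.assoc)
qed

lemma norm_transpose_mult_le:
  fixes D :: "real ^ 'n ^ 's"
  assumes "\<And>v. norm (D *v v) \<le> B * norm v"
  shows "norm (transpose D *v u) \<le> B * norm u"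
proof (cases "transpose D *v u = 0")
  case True
  have "0 \<le> B"
    using assms[of "axis undefined 1"] norm_ge_zero[of "D *v axis undefined 1"]
    by (simp del: norm_ge_zero)
  with True show ?thesis by simp
next
  case False
  have "norm (transpose D *v u) * norm (transpose D *v u) = (D *v (transpose D *v u)) \<bullet> u"
    by (simp add: dot_lmul_matrix flip: power2_norm_eq_inner power2_eq_square)
       (metis dot_lmul_matrix inner_commute power2_norm_eq_inner transpose_matrix_vector)
  also have "\<dots> \<le> norm (D *v (transpose D *v u)) * norm u" by (rule norm_cauchy_schwarz)
  also have "\<dots> \<le> (B * norm (transpose D *v u)) * norm u"
    using assms by (simp add: mult_right_mono)
  finally show ?thesis using False by (simp add: mult_ac)
qed

lemma squared_error_le_potential:
  fixes D :: "real ^ 'n ^ 's"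
  assumes D: "\<And>v. norm (D *v v) \<le> B * norm v"
    and \<beta>: "(\<Sum>i\<in>{1..<k}. (norm (D *v x i))\<^sup>2) \<le> \<beta>"
    and y: "gram x k *v y = v"
  shows "(norm (D *v v))\<^sup>2 \<le> (B\<^sup>2 + \<beta>) * (v \<bullet> y)"
proof (cases "D *v v = 0")
  case True
  have "0 \<le> v \<bullet> y"
    using order_trans[OF zero_le_power2 gram_inner_self_ge[of y x k]] by (simp add: y inner_commute)
  moreover have "0 \<le> \<beta>"
    using \<beta> sum_nonneg[of "{1..<k}" "\<lambda>i. (norm (D *v x i))\<^sup>2"] by simp
  ultimately show ?thesis using True by simp
next
  case False
  define u where "u = D *v v"
  define w where "w = transpose D *v u"
  have w_inner: "w \<bullet> z = u \<bullet> (D *v z)" for z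
    unfolding w_def by (metis dot_lmul_matrix transpose_matrix_vector)
  have "((norm u)\<^sup>2)\<^sup>2 = (w \<bullet> (gram x k *v y))\<^sup>2"
    by (simp add: y w_inner u_def power2_norm_eq_inner)
  also have "\<dots> \<le> (w \<bullet> (gram x k *v w)) * (y \<bullet> (gram x k *v y))"
    by (rule gram_Cauchy_Schwarz)
  also have "\<dots> \<le> ((B\<^sup>2 + \<beta>) * (norm u)\<^sup>2) * (v \<bullet> y)"
  proof (rule mult_mono)
    have "(norm w)\<^sup>2 \<le> (B * norm u)\<^sup>2"
      unfolding w_def using norm_transpose_mult_le[OF D] by (intro power_mono) auto
    moreover have "(\<Sum>i\<in>{1..<k}. (w \<bullet> x i)\<^sup>2)
        \<le> (\<Sum>i\<in>{1..<k}. (norm u)\<^sup>2 * (norm (D *v x i))\<^sup>2)"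
      by (intro sum_mono) (simp add: w_inner Cauchy_Schwarz_ineq power2_norm_eq_inner)
    moreover have "\<dots> \<le> (norm u)\<^sup>2 * \<beta>"
      using \<beta> by (simp add: mult_left_mono flip: sum_distrib_left)
    moreover have "w \<bullet> (gram x k *v w) = (norm w)\<^sup>2 + (\<Sum>i\<in>{1..<k}. (w \<bullet> x i)\<^sup>2)"
      by (simp add: inner_gram power2_norm_eq_inner flip: power2_eq_square)
    ultimately show "w \<bullet> (gram x k *v w) \<le> (B\<^sup>2 + \<beta>) * (norm u)\<^sup>2"
      by (simp add: power_mult_distrib distrib_right mult.commute[of _ \<beta>])
    have "0 \<le> \<beta>"
      using \<beta> sum_nonneg[of "{1..<k}" "\<lambda>i. (norm (D *v x i))\<^sup>2"] by simp
    then show "0 \<le> (B\<^sup>2 + \<beta>) * (norm u)\<^sup>2" by simp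
    show "0 \<le> y \<bullet> (gram x k *v y)"
      using gram_inner_self_ge[of y x k] zero_le_power2[of "norm y"] by linarith
  qed (simp add: y inner_commute)
  finally have "(norm u)\<^sup>2 * (norm u)\<^sup>2 \<le> ((B\<^sup>2 + \<beta>) * (v \<bullet> y)) * (norm u)\<^sup>2"
    by (simp only: power2_eq_square mult_ac)
  with False show ?thesis
    unfolding u_def by (subst (asm) mult_le_cancel_right) (simp add: not_less_iff_gr_or_eq)
qed

lemma eluder_bound:
  fixes D :: "nat \<Rightarrow> real ^ 'n ^ 's" and x :: "nat \<Rightarrow> real ^ 'n"
  assumes x: "\<And>i. i \<in> {1..K} \<Longrightarrow> norm (x i) \<le> 1"
    and D: "\<And>i v. i \<in> {1..K} \<Longrightarrow> norm (D i *v v) \<le> 2 * R * norm v"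
    and \<beta>: "\<And>k. k \<in> {1..K} \<Longrightarrow> (\<Sum>i\<in>{1..<k}. (norm (D k *v x i))\<^sup>2) \<le> \<beta>"
    and "R\<^sup>2 \<le> \<beta>" "K \<ge> 2" and k: "k \<in> {1..K}"
  shows "(\<Sum>i\<in>{1..k}. (norm (D i *v x i))\<^sup>2) \<le> 20 * (real CARD('n) * \<beta> * ln (real K))"
proof -
  have "\<forall>i. \<exists>y. gram x i *v y = x i"
    using gram_solve by blast
  then obtain y where y: "\<And>i. gram x i *v y i = x i"
    by metis
  have "\<beta> \<ge> 0" using \<open>R\<^sup>2 \<le> \<beta>\<close> zero_le_power2[of R] by linarith
  have "(\<Sum>i\<in>{1..k}. (norm (D i *v x i))\<^sup>2) \<le> (\<Sum>i\<in>{1..K}. (norm (D i *v x i))\<^sup>2)"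
    using k by (intro sum_mono2) auto
  also have "\<dots> \<le> (\<Sum>i\<in>{1..K}. 5 * \<beta> * (x i \<bullet> y i))"
  proof (rule sum_mono)
    fix i assume i: "i \<in> {1..K}"
    have "(norm (D i *v x i))\<^sup>2 \<le> ((2 * R)\<^sup>2 + \<beta>) * (x i \<bullet> y i)"
      using D[OF i] \<beta>[OF i] y by (rule squared_error_le_potential)
    also have "\<dots> \<le> (5 * \<beta>) * (x i \<bullet> y i)"
    proof (rule mult_right_mono)
      show "0 \<le> x i \<bullet> y i"
        using order_trans[OF zero_le_power2 gram_inner_self_ge[of "y i" x i]]
        by (simp add: y inner_commute)
    qed (use \<open>R\<^sup>2 \<le> \<beta>\<close> in \<open>simp add: power_mult_distrib\<close>)
    finally show "(norm (D i *v x i))\<^sup>2 \<le> 5 * \<beta> * (x i \<bullet> y i)" .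
  qed
  also have "\<dots> = 5 * \<beta> * (\<Sum>i\<in>{1..K}. x i \<bullet> y i)"
    by (simp add: sum_distrib_left)
  also have "\<dots> \<le> 5 * \<beta> * (2 * real CARD('n) * ln (1 + real K))"
    by (intro mult_left_mono elliptical_potential) (use x y \<open>\<beta> \<ge> 0\<close> in auto)
  also have "\<dots> \<le> 5 * \<beta> * (2 * real CARD('n) * (2 * ln (real K)))"
  proof -
    have "1 + real K \<le> real K ^ 2"
      using \<open>K \<ge> 2\<close> mult_right_mono[of 2 "real K" "real K"]
      unfolding power2_eq_square by linarith
    then have "ln (1 + real K) \<le> ln (real K ^ 2)" by (intro ln_mono) auto
    then have "ln (1 + real K) \<le> 2 * ln (real K)" using \<open>K \<ge> 2\<close> by (simp add: ln_realpow)
    then show ?thesis using \<open>\<beta> \<ge> 0\<close> by (intro mult_left_mono) auto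
  qed
  finally show ?thesis by (simp add: mult_ac)
qed

section \<open>Gaussian noise\<close>

lemma Basis_vec_real: "(Basis :: (real ^ 's) set) = range (\<lambda>i. axis i 1)"
  by (auto simp: Basis_vec_def)

lemma sets_gaussian_noise [simp, measurable_cong]: "sets (gaussian_noise \<sigma>) = sets borel"
  by (simp add: gaussian_noise_def)

lemma space_gaussian_noise [simp]: "space (gaussian_noise \<sigma>) = UNIV"
  by (simp add: gaussian_noise_def)

lemma prob_space_gaussian_noise:
  assumes "\<sigma> > 0"
  shows "prob_space (gaussian_noise \<sigma> :: (real ^ 's) measure)"
proof (rule prob_spaceI)
  have inj: "inj (\<lambda>i::'s. axis i (1::real))"
    by (auto intro: injI simp: axis_eq_axis)
  have "emeasure (gaussian_noise \<sigma> :: (real ^ 's) measure) (space (gaussian_noise \<sigma>))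
     = (\<integral>\<^sup>+x. (\<Prod>i\<in>UNIV. ennreal (normal_density 0 \<sigma> ((x :: real ^ 's) $ i))) \<partial>lborel)"
    by (simp add: gaussian_noise_def emeasure_density prod_ennreal)
  also have "\<dots> = (\<integral>\<^sup>+x. (\<Prod>b\<in>Basis. ennreal (normal_density 0 \<sigma> ((x :: real ^ 's) \<bullet> b))) \<partial>lborel)"
    unfolding Basis_vec_real by (subst prod.reindex[OF inj]) (simp add: inner_axis)
  also have "\<dots> = (\<Prod>b\<in>(Basis :: (real ^ 's) set). \<integral>\<^sup>+x. ennreal (normal_density 0 \<sigma> x) \<partial>lborel)"
    by (rule nn_integral_lborel_prod) auto
  also have "(\<integral>\<^sup>+x. ennreal (normal_density 0 \<sigma> x) \<partial>lborel) = 1"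
    using prob_space.emeasure_space_1[OF prob_space_normal_density[OF assms, of 0]]
    by (simp add: emeasure_density)
  finally show "emeasure (gaussian_noise \<sigma> :: (real ^ 's) measure) (space (gaussian_noise \<sigma>)) = 1"
    by simp
qed

lemma gaussian_density_shift:
  fixes m x :: "real ^ 's"
  assumes "\<sigma> > 0"
  shows "(\<Prod>i\<in>UNIV. normal_density 0 \<sigma> ((x - m) $ i))
    = (\<Prod>i\<in>UNIV. normal_density 0 \<sigma> (x $ i)) * exp (m \<bullet> x / \<sigma>\<^sup>2 - (norm m)\<^sup>2 / (2 * \<sigma>\<^sup>2))"
proof -
  have "(\<Prod>i\<in>UNIV. normal_density 0 \<sigma> ((x - m) $ i))
    = (\<Prod>i\<in>UNIV. normal_density 0 \<sigma> (x $ i) *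
         exp (m $ i * x $ i / \<sigma>\<^sup>2 - (m $ i)\<^sup>2 / (2 * \<sigma>\<^sup>2)))"
  proof (rule prod.cong)
    fix i
    have "exp (- ((x - m) $ i)\<^sup>2 / (2 * \<sigma>\<^sup>2))
      = exp (- (x $ i)\<^sup>2 / (2 * \<sigma>\<^sup>2)) * exp (m $ i * x $ i / \<sigma>\<^sup>2 - (m $ i)\<^sup>2 / (2 * \<sigma>\<^sup>2))"
      using assms unfolding exp_add[symmetric]
      by (simp add: power2_diff diff_divide_distrib add_divide_distrib)
    then show "normal_density 0 \<sigma> ((x - m) $ i) = normal_density 0 \<sigma> (x $ i) *
         exp (m $ i * x $ i / \<sigma>\<^sup>2 - (m $ i)\<^sup>2 / (2 * \<sigma>\<^sup>2))"
      by (simp add: normal_density_def)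
  qed simp
  also have "\<dots> = (\<Prod>i\<in>UNIV. normal_density 0 \<sigma> (x $ i)) *
      exp (\<Sum>i\<in>UNIV. m $ i * x $ i / \<sigma>\<^sup>2 - (m $ i)\<^sup>2 / (2 * \<sigma>\<^sup>2))"
    by (simp add: prod.distrib exp_sum)
  also have "(\<Sum>i\<in>UNIV. m $ i * x $ i / \<sigma>\<^sup>2 - (m $ i)\<^sup>2 / (2 * \<sigma>\<^sup>2))
      = m \<bullet> x / \<sigma>\<^sup>2 - (norm m)\<^sup>2 / (2 * \<sigma>\<^sup>2)"
    unfolding power2_norm_eq_inner
    by (simp add: sum_subtractf inner_vec_def power2_eq_square flip: sum_divide_distrib)
  finally show ?thesis .
qed

lemma gaussian_noise_shift:
  fixes m :: "real ^ 's"
  assumes "\<sigma> > 0"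
  shows "distr (gaussian_noise \<sigma>) borel ((+) m) =
    density (gaussian_noise \<sigma>) (\<lambda>x. ennreal (exp (m \<bullet> x / \<sigma>\<^sup>2 - (norm m)\<^sup>2 / (2 * \<sigma>\<^sup>2))))"
    (is "?L = ?R")
proof (rule measure_eqI)
  fix E assume "E \<in> sets ?L"
  then have [measurable]: "E \<in> sets borel" by simp
  let ?q = "\<lambda>x :: real ^ 's. \<Prod>i\<in>UNIV. normal_density 0 \<sigma> (x $ i)"
  have [measurable]: "(+) m -` E \<in> sets borel"
    using measurable_sets[of "(+) m" borel borel E] by simp
  have "emeasure ?L E = (\<integral>\<^sup>+x. ennreal (?q x) * indicator E (m + x) \<partial>lborel)"
    by (subst emeasure_distr)
       (auto simp: gaussian_noise_def emeasure_density indicator_def intro!: nn_integral_cong)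
  also have "\<dots> = (\<integral>\<^sup>+x. ennreal (?q (x - m)) * indicator E x \<partial>distr lborel borel ((+) m))"
    by (subst nn_integral_distr) auto
  also have "\<dots> = (\<integral>\<^sup>+x. ennreal (?q (x - m)) * indicator E x \<partial>lborel)"
    by (simp add: lborel_distr_plus)
  also have "\<dots> = emeasure ?R E"
    by (simp add: gaussian_noise_def density_density_eq emeasure_density ennreal_mult prod_nonneg
        gaussian_density_shift[OF assms] del: vector_minus_component)
  finally show "emeasure ?L E = emeasure ?R E" .
qed simp

lemma integral_gaussian_noise_shift:
  fixes m :: "real ^ 's" and g :: "real ^ 's \<Rightarrow> real"
  assumes "\<sigma> > 0" and [measurable]: "g \<in> borel_measurable borel"
  shows "(\<integral>x. g (m + x) \<partial>gaussian_noise \<sigma>) =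
    (\<integral>x. exp (m \<bullet> x / \<sigma>\<^sup>2 - (norm m)\<^sup>2 / (2 * \<sigma>\<^sup>2)) * g x \<partial>gaussian_noise \<sigma>)"
proof -
  have "(\<integral>x. g (m + x) \<partial>gaussian_noise \<sigma>) = (\<integral>x. g x \<partial>distr (gaussian_noise \<sigma>) borel ((+) m))"
    by (rule integral_distr[symmetric]) auto
  also have "\<dots> = (\<integral>x. exp (m \<bullet> x / \<sigma>\<^sup>2 - (norm m)\<^sup>2 / (2 * \<sigma>\<^sup>2)) * g x \<partial>gaussian_noise \<sigma>)"
    unfolding gaussian_noise_shift[OF assms(1)] by (subst integral_density) auto
  finally show ?thesis .
qed

lemma gaussian_noise_mgf:
  fixes v :: "real ^ 's"
  assumes "\<sigma> > 0"
  shows "has_bochner_integral (gaussian_noise \<sigma>) (\<lambda>x. exp (v \<bullet> x)) (exp (\<sigma>\<^sup>2 * (norm v)\<^sup>2 / 2))"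
proof -
  define m where "m = \<sigma>\<^sup>2 *\<^sub>R v"
  define c where "c = \<sigma>\<^sup>2 * (norm v)\<^sup>2 / 2"
  have m: "m \<bullet> x / \<sigma>\<^sup>2 - (norm m)\<^sup>2 / (2 * \<sigma>\<^sup>2) = v \<bullet> x - c" for x
    using assms by (simp add: m_def c_def power_mult_distrib power2_eq_square)
  interpret prob_space "gaussian_noise \<sigma> :: (real ^ 's) measure"
    using assms by (rule prob_space_gaussian_noise)
  have "prob_space (distr (gaussian_noise \<sigma>) borel ((+) m))"
    by (rule prob_space_distr) simp
  from prob_space.emeasure_space_1[OF this]
  have "(\<integral>\<^sup>+x. ennreal (exp (v \<bullet> x - c)) \<partial>gaussian_noise \<sigma>) = 1"
    unfolding gaussian_noise_shift[OF assms] m by (simp add: emeasure_density)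
  then have "has_bochner_integral (gaussian_noise \<sigma>) (\<lambda>x. exp (v \<bullet> x - c)) 1"
    by (intro has_bochner_integral_nn_integral) auto
  then have "has_bochner_integral (gaussian_noise \<sigma>) (\<lambda>x. exp c * exp (v \<bullet> x - c)) (exp c * 1)"
    by (rule has_bochner_integral_mult_right)
  then show ?thesis by (simp add: c_def flip: exp_add)
qed

lemma integrable_gaussian_noise_id:
  assumes "\<sigma> > 0"
  shows "integrable (gaussian_noise \<sigma>) (\<lambda>x :: real ^ 's. x)"
proof -
  have "integrable (gaussian_noise \<sigma>) (\<lambda>x :: real ^ 's. x \<bullet> b)" for b
  proof (rule Bochner_Integration.integrable_bound)
    show "integrable (gaussian_noise \<sigma>) (\<lambda>x :: real ^ 's. exp (b \<bullet> x) + exp ((- b) \<bullet> x))"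
      using gaussian_noise_mgf[OF assms, of b] gaussian_noise_mgf[OF assms, of "- b"]
      by (intro Bochner_Integration.integrable_add) (auto intro: integrable.intros)
    have "\<bar>t\<bar> \<le> exp t + exp (- t)" for t :: real
      using exp_ge_add_one_self[of t] exp_ge_add_one_self[of "- t"]
        exp_gt_zero[of t] exp_gt_zero[of "- t"] by linarith
    then show "AE x in gaussian_noise \<sigma>. norm (x \<bullet> b) \<le> norm (exp (b \<bullet> x) + exp ((- b) \<bullet> x))"
      by (intro always_eventually allI) (simp add: inner_commute add_nonneg_nonneg)
  qed simp
  then have "integrable (gaussian_noise \<sigma>) (\<lambda>x :: real ^ 's. \<Sum>b\<in>Basis. (x \<bullet> b) *\<^sub>R b)"
    by (intro Bochner_Integration.integrable_sum integrable_scaleR_left)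
  then show ?thesis by (simp add: euclidean_representation)
qed

lemma distr_uminus_gaussian_noise:
  "distr (gaussian_noise \<sigma>) borel uminus = (gaussian_noise \<sigma> :: (real ^ 's) measure)"
proof (rule measure_eqI)
  fix E assume "E \<in> sets (distr (gaussian_noise \<sigma>) borel uminus :: (real ^ 's) measure)"
  then have [measurable]: "E \<in> sets borel" by simp
  let ?q = "\<lambda>x :: real ^ 's. \<Prod>i\<in>UNIV. normal_density 0 \<sigma> (x $ i)"
  have [measurable]: "uminus -` E \<in> sets borel"
    using measurable_sets[of uminus borel borel E] by simp
  have "emeasure (distr (gaussian_noise \<sigma>) borel uminus) E
      = (\<integral>\<^sup>+x. ennreal (?q x) * indicator E (- x) \<partial>lborel)"
    by (subst emeasure_distr)
       (auto simp: gaussian_noise_def emeasure_density indicator_def intro!: nn_integral_cong)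
  also have "\<dots> = (\<integral>\<^sup>+x. ennreal (?q x) * indicator E x \<partial>distr lborel borel uminus)"
    by (subst nn_integral_distr) (auto simp: normal_density_def)
  also have "\<dots> = emeasure (gaussian_noise \<sigma>) E"
    using lborel_affine[of "- 1" "0 :: real ^ 's"]
    by (simp add: density_1 gaussian_noise_def emeasure_density)
  finally show "emeasure (distr (gaussian_noise \<sigma>) borel uminus) E = emeasure (gaussian_noise \<sigma>) E" .
qed simp

lemma integral_gaussian_noise_id: "(\<integral>x. x \<partial>gaussian_noise \<sigma>) = (0 :: real ^ 's)"
proof -
  have "(\<integral>x. x \<partial>gaussian_noise \<sigma>) = (\<integral>x. x \<partial>distr (gaussian_noise \<sigma>) borel (uminus :: real ^ 's \<Rightarrow> real ^ 's))"
    by (simp add: distr_uminus_gaussian_noise)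
  also have "\<dots> = - (\<integral>x. x \<partial>gaussian_noise \<sigma>)"
    by (subst integral_distr) auto
  finally show ?thesis by (simp add: eq_neg_iff_add_eq_0 flip: scaleR_2)
qed

lemma gaussian_noise_inner_tail:
  fixes v :: "real ^ 's"
  assumes "\<sigma> > 0" "norm v = 1" "t \<ge> 0"
  shows "measure (gaussian_noise \<sigma>) {x. v \<bullet> x \<ge> \<sigma> * t} \<le> exp (- t\<^sup>2 / 2)"
proof -
  interpret prob_space "gaussian_noise \<sigma> :: (real ^ 's) measure"
    using assms(1) by (rule prob_space_gaussian_noise)
  let ?c = "t / \<sigma>"
  have mgf: "has_bochner_integral (gaussian_noise \<sigma>) (\<lambda>x. exp (?c * (v \<bullet> x))) (exp (t\<^sup>2 / 2))"
    using gaussian_noise_mgf[OF assms(1), of "?c *\<^sub>R v"] assms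
    by (simp add: power_mult_distrib power_divide)
  have "measure (gaussian_noise \<sigma>) {x. v \<bullet> x \<ge> \<sigma> * t}
      \<le> measure (gaussian_noise \<sigma>) {x \<in> space (gaussian_noise \<sigma>). exp (?c * (v \<bullet> x)) \<ge> exp (t\<^sup>2)}"
  proof (rule finite_measure_mono)
    have "?c * (v \<bullet> x) \<ge> t\<^sup>2" if "v \<bullet> x \<ge> \<sigma> * t" for x
      using mult_left_mono[OF that, of ?c] assms by (simp add: power2_eq_square)
    then show "{x. v \<bullet> x \<ge> \<sigma> * t} \<subseteq> {x \<in> space (gaussian_noise \<sigma>). exp (?c * (v \<bullet> x)) \<ge> exp (t\<^sup>2)}"
      by auto
  qed measurable
  also have "\<dots> \<le> (\<integral>x. exp (?c * (v \<bullet> x)) \<partial>gaussian_noise \<sigma>) / exp (t\<^sup>2)"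
    using mgf by (intro integral_Markov_inequality_measure[where A = "{}"]) (auto intro: integrable.intros)
  also have "\<dots> = exp (t\<^sup>2 / 2) / exp (t\<^sup>2)"
    using mgf by (simp add: has_bochner_integral_integral_eq)
  also have "\<dots> = exp (- t\<^sup>2 / 2)"
    by (simp flip: exp_diff)
  finally show ?thesis .
qed

lemma gaussian_noise_norm_tail:
  assumes "\<sigma> > 0" "0 < \<delta>" "\<delta> < 1"
  shows "measure (gaussian_noise \<sigma>)
      {x :: real ^ 's. norm x \<le> \<sigma> * sqrt (2 * real CARD('s) * ln (2 * real CARD('s) / \<delta>))} \<ge> 1 - \<delta>"
proof -
  interpret prob_space "gaussian_noise \<sigma> :: (real ^ 's) measure"
    using assms(1) by (rule prob_space_gaussian_noise)
  let ?d = "real CARD('s)"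
  define t where "t = sqrt (2 * ln (2 * ?d / \<delta>))"
  have d: "?d \<ge> 1" by (simp add: Suc_le_eq)
  have "\<delta> \<le> 2 * ?d" using d assms by linarith
  then have "2 * ?d / \<delta> \<ge> 1" using assms by simp
  then have "ln (2 * ?d / \<delta>) \<ge> 0" by simp
  then have t: "t \<ge> 0" "t\<^sup>2 = 2 * ln (2 * ?d / \<delta>)" by (auto simp: t_def)
  have tail: "exp (- t\<^sup>2 / 2) = \<delta> / (2 * ?d)"
    using d assms by (simp add: t(2) exp_minus field_simps)
  let ?B = "\<lambda>i. {x :: real ^ 's. axis i 1 \<bullet> x \<ge> \<sigma> * t} \<union> {x. (- axis i 1) \<bullet> x \<ge> \<sigma> * t}"
  have B: "prob (?B i) \<le> \<delta> / ?d" for i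
  proof -
    have "prob (?B i) \<le> prob {x. axis i 1 \<bullet> x \<ge> \<sigma> * t} + prob {x. (- axis i 1) \<bullet> x \<ge> \<sigma> * t}"
      by (rule measure_Un_le) measurable
    also have "\<dots> \<le> exp (- t\<^sup>2 / 2) + exp (- t\<^sup>2 / 2)"
      using assms t by (intro add_mono gaussian_noise_inner_tail) auto
    finally show ?thesis using tail by simp
  qed
  have "prob (\<Union>i\<in>UNIV. ?B i) \<le> (\<Sum>i\<in>UNIV. prob (?B i))"
    by (rule finite_measure_subadditive_finite) auto
  also have "\<dots> \<le> (\<Sum>i\<in>(UNIV :: 's set). \<delta> / ?d)"
    by (intro sum_mono B)
  also have "\<dots> = \<delta>" by simp
  finally have "1 - \<delta> \<le> prob (space (gaussian_noise \<sigma>) - (\<Union>i\<in>UNIV. ?B i))"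
    by (subst prob_compl) auto
  also have "\<dots> \<le> prob {x. norm x \<le> \<sigma> * sqrt (2 * ?d * ln (2 * ?d / \<delta>))}"
  proof (rule finite_measure_mono)
    have "norm x \<le> \<sigma> * sqrt (2 * ?d * ln (2 * ?d / \<delta>))" if "\<And>i. \<bar>x $ i\<bar> \<le> \<sigma> * t" for x :: "real ^ 's"
    proof -
      have "(norm x)\<^sup>2 = (\<Sum>i\<in>UNIV. (x $ i)\<^sup>2)"
        by (simp add: norm_vec_def L2_set_def sum_nonneg)
      also have "\<dots> \<le> (\<Sum>i\<in>(UNIV :: 's set). (\<sigma> * t)\<^sup>2)"
        using that by (intro sum_mono) (metis abs_ge_zero power2_abs power_mono)
      also have "\<dots> = (\<sigma> * sqrt (2 * ?d * ln (2 * ?d / \<delta>)))\<^sup>2"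
        using \<open>ln (2 * ?d / \<delta>) \<ge> 0\<close> by (simp add: power_mult_distrib t(2))
      finally show ?thesis
        by (rule power2_le_imp_le) (use assms \<open>ln (2 * ?d / \<delta>) \<ge> 0\<close> in simp)
    qed
    moreover have "\<bar>x $ i\<bar> \<le> \<sigma> * t" if "x \<notin> (\<Union>i\<in>UNIV. ?B i)" for x :: "real ^ 's" and i
    proof -
      have "x $ i < \<sigma> * t" "- (x $ i) < \<sigma> * t"
        using that by (simp_all add: inner_axis' not_le)
      then show ?thesis by linarith
    qed
    ultimately show "space (gaussian_noise \<sigma>) - (\<Union>i\<in>UNIV. ?B i)
        \<subseteq> {x. norm x \<le> \<sigma> * sqrt (2 * ?d * ln (2 * ?d / \<delta>))}"
      by blast
  qed measurable
  finally show ?thesis .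
qed

text \<open>
  The total variation distance of two shifted Gaussians is bounded through their chi-square
  divergence.
\<close>

lemma gaussian_noise_shift_diff:
  fixes a b :: "real ^ 's" and G :: "real ^ 's \<Rightarrow> real"
  assumes "\<sigma> > 0" and [measurable]: "G \<in> borel_measurable borel"
    and G: "\<And>x. 0 \<le> G x" "\<And>x. G x \<le> 1"
  shows "(\<integral>x. G (a + x) \<partial>gaussian_noise \<sigma>) - (\<integral>x. G (b + x) \<partial>gaussian_noise \<sigma>)
      \<le> 2 / \<sigma> * norm (a - b)"
proof -
  let ?\<gamma> = "gaussian_noise \<sigma> :: (real ^ 's) measure"
  interpret prob_space ?\<gamma>
    using assms(1) by (rule prob_space_gaussian_noise)
  define m where "m = a - b"
  define l where "l = norm m / \<sigma>"
  define g where "g x = G (b + x)" for x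
  define e where "e x = exp (m \<bullet> x / \<sigma>\<^sup>2 - (norm m)\<^sup>2 / (2 * \<sigma>\<^sup>2))" for x
  have [measurable]: "g \<in> borel_measurable borel" "e \<in> borel_measurable borel"
    unfolding g_def e_def by measurable
  have g: "0 \<le> g x" "g x \<le> 1" for x
    using G by (auto simp: g_def)
  have int_g: "integrable ?\<gamma> (\<lambda>x. g (c + x))" for c
    using g by (intro integrable_const_bound[of _ 1]) auto
  have split: "(\<integral>x. G (a + x) \<partial>?\<gamma>) = (\<integral>x. g (m + x) \<partial>?\<gamma>)"
    "(\<integral>x. G (b + x) \<partial>?\<gamma>) = (\<integral>x. g (0 + x) \<partial>?\<gamma>)"
    by (simp_all add: g_def m_def add.assoc[symmetric])
  consider "l = 0" | "0 < l" "l \<le> 1" | "l > 1"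
    using assms(1) by (fastforce simp: l_def)
  then have "(\<integral>x. g (m + x) \<partial>?\<gamma>) - (\<integral>x. g (0 + x) \<partial>?\<gamma>) \<le> 2 * l"
  proof cases
    case 1
    then have "m = 0" using assms(1) by (simp add: l_def)
    then show ?thesis by (simp add: l_def)
  next
    case 3
    have "(\<integral>x. g (m + x) \<partial>?\<gamma>) \<le> (\<integral>x. 1 \<partial>?\<gamma>)"
      by (rule integral_mono[OF int_g]) (auto simp: g)
    moreover have "0 \<le> (\<integral>x. g (0 + x) \<partial>?\<gamma>)"
      by (rule integral_nonneg_AE) (auto simp: g)
    ultimately show ?thesis using 3 prob_space by simp
  next
    case 2
    have mgf: "has_bochner_integral ?\<gamma> (\<lambda>x. (e x) ^ n)
        (exp (real n * (real n - 1) * l\<^sup>2 / 2))" for n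
    proof -
      have "has_bochner_integral ?\<gamma> (\<lambda>x. exp (- (real n * (l\<^sup>2 / 2))) * exp (((real n / \<sigma>\<^sup>2) *\<^sub>R m) \<bullet> x))
          (exp (- (real n * (l\<^sup>2 / 2))) * exp (\<sigma>\<^sup>2 * (norm ((real n / \<sigma>\<^sup>2) *\<^sub>R m))\<^sup>2 / 2))"
        by (intro has_bochner_integral_mult_right gaussian_noise_mgf assms(1))
      also have "(\<lambda>x. exp (- (real n * (l\<^sup>2 / 2))) * exp (((real n / \<sigma>\<^sup>2) *\<^sub>R m) \<bullet> x)) = (\<lambda>x. e x ^ n)"
        by (simp add: e_def l_def power_divide algebra_simps flip: exp_add exp_of_nat_mult)
      also have "exp (- (real n * (l\<^sup>2 / 2))) * exp (\<sigma>\<^sup>2 * (norm ((real n / \<sigma>\<^sup>2) *\<^sub>R m))\<^sup>2 / 2)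
          = exp (real n * (real n - 1) * l\<^sup>2 / 2)"
        unfolding exp_add[symmetric] using assms(1)
        by (simp add: l_def power_divide power_mult_distrib field_simps power2_eq_square)
      finally show ?thesis .
    qed
    have e1: "integrable ?\<gamma> e" "(\<integral>x. e x \<partial>?\<gamma>) = 1"
      using mgf[of 1] by (auto intro: integrable.intros simp: has_bochner_integral_integral_eq)
    have e2: "integrable ?\<gamma> (\<lambda>x. (e x)\<^sup>2)" "(\<integral>x. (e x)\<^sup>2 \<partial>?\<gamma>) = exp (l\<^sup>2)"
      using mgf[of 2] by (auto intro: integrable.intros simp: has_bochner_integral_integral_eq)
    have int_eg: "integrable ?\<gamma> (\<lambda>x. e x * g x)"
      by (rule Bochner_Integration.integrable_bound[OF e1(1)])
         (auto simp: e_def g abs_mult intro!: mult_left_le)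
    have "(\<integral>x. g (m + x) \<partial>?\<gamma>) - (\<integral>x. g (0 + x) \<partial>?\<gamma>) = (\<integral>x. e x * g x - g x \<partial>?\<gamma>)"
      using int_eg int_g[of 0]
      by (simp add: integral_gaussian_noise_shift[OF assms(1)] e_def)
    also have "\<dots> \<le> (\<integral>x. l / 2 + ((e x)\<^sup>2 - 2 * e x + 1) / (2 * l) \<partial>?\<gamma>)"
    proof (rule integral_mono)
      fix x
      have "e x * g x - g x = g x * (e x - 1)" by (simp add: algebra_simps)
      also have "\<dots> \<le> \<bar>e x - 1\<bar>"
        using g[of x] mult_left_le_one_le[of "\<bar>e x - 1\<bar>" "g x"] abs_mult[of "g x" "e x - 1"] by simp
      also have "\<dots> \<le> l / 2 + (e x - 1)\<^sup>2 / (2 * l)"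
      proof -
        have "0 \<le> (l - \<bar>e x - 1\<bar>)\<^sup>2" by simp
        then have "2 * l * \<bar>e x - 1\<bar> \<le> l\<^sup>2 + (e x - 1)\<^sup>2" by (simp add: power2_diff)
        then show ?thesis using \<open>l > 0\<close> by (simp add: field_simps power2_eq_square)
      qed
      also have "(e x - 1)\<^sup>2 = (e x)\<^sup>2 - 2 * e x + 1" by (simp add: power2_diff)
      finally show "e x * g x - g x \<le> l / 2 + ((e x)\<^sup>2 - 2 * e x + 1) / (2 * l)" .
    qed (use int_eg int_g[of 0] e1 e2 in auto)
    also have "\<dots> = l / 2 + (exp (l\<^sup>2) - 1) / (2 * l)"
      using e1 e2 by (simp add: prob_space[simplified])
    also have "\<dots> \<le> l / 2 + l"
    proof -
      have "l\<^sup>2 \<le> 1" using 2 by (simp add: power_le_one)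
      then have "exp (l\<^sup>2) \<le> 1 + l\<^sup>2 + (l\<^sup>2)\<^sup>2" by (intro exp_bound) auto
      also have "(l\<^sup>2)\<^sup>2 \<le> l\<^sup>2"
        using mult_left_le[OF \<open>l\<^sup>2 \<le> 1\<close>, of "l\<^sup>2"] unfolding power2_eq_square[of "l\<^sup>2"] by simp
      finally have "exp (l\<^sup>2) - 1 \<le> l * (2 * l)" by (simp add: power2_eq_square)
      then show ?thesis using 2 by (simp add: pos_divide_le_eq)
    qed
    finally show ?thesis using 2 by linarith
  qed
  then show ?thesis
    unfolding split by (simp add: l_def m_def)
qed

section \<open>Comparison of two models along a policy\<close>

locale knr =
  fixes H :: nat and A :: "'a measure" and s\<^sub>1 :: "real ^ 's"
    and r :: "nat \<Rightarrow> (real ^ 's) \<times> 'a \<Rightarrow> real"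
    and \<phi> :: "(real ^ 's) \<times> 'a \<Rightarrow> real ^ 'n" and \<sigma> :: real
    and \<pi> :: "(real ^ 's, 'a) policy"
  assumes \<sigma>: "\<sigma> > 0"
    and \<phi> [measurable]: "\<phi> \<in> borel \<Otimes>\<^sub>M A \<rightarrow>\<^sub>M borel"
    and norm_\<phi>: "\<And>\<eta>. \<eta> \<in> UNIV \<times> space A \<Longrightarrow> norm (\<phi> \<eta>) \<le> 1"
    and \<pi>: "\<And>h. h \<in> {1..H} \<Longrightarrow> \<pi> h \<in> borel \<rightarrow>\<^sub>M A"
begin

abbreviation paths :: "(nat \<Rightarrow> real ^ 's) measure" where
  "paths \<equiv> Pi\<^sub>M UNIV (\<lambda>_. borel)"

abbreviation model :: "(nat \<Rightarrow> real ^ 'n ^ 's) \<Rightarrow> (real ^ 's, 'a) mdp" where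
  "model U \<equiv> knr_mdp H A s\<^sub>1 r \<phi> \<sigma> U"

definition law :: "(nat \<Rightarrow> real ^ 'n ^ 's) \<Rightarrow> nat \<Rightarrow> (nat \<Rightarrow> real ^ 's) measure" where
  "law U n = path_law (model U) \<pi> 1 s\<^sub>1 n"

abbreviation state_action :: "nat \<Rightarrow> (nat \<Rightarrow> real ^ 's) \<Rightarrow> (real ^ 's) \<times> 'a" where
  "state_action h w \<equiv> (w h, \<pi> h (w h))"

definition extend :: "(nat \<Rightarrow> real ^ 'n ^ 's) \<Rightarrow> nat \<Rightarrow> (nat \<Rightarrow> real ^ 's) \<Rightarrow> real ^ 's \<Rightarrow> nat \<Rightarrow> real ^ 's"
where
  "extend U n w \<epsilon> = w(Suc (Suc n) := U (Suc n) *v \<phi> (state_action (Suc n) w) + \<epsilon>)"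

lemma measurable_state_action:
  assumes "h \<in> {1..H}"
  shows "state_action h \<in> paths \<rightarrow>\<^sub>M borel \<Otimes>\<^sub>M A"
  using \<pi>[OF assms] by measurable

lemma state_action_in:
  assumes "h \<in> {1..H}"
  shows "state_action h w \<in> UNIV \<times> space A"
  using measurable_space[OF \<pi>[OF assms]] by auto

lemma measurable_matrix_vector_mult [measurable]:
  "(\<lambda>x. (B :: real ^ 'n ^ 's) *v x) \<in> borel \<rightarrow>\<^sub>M borel"
  by (intro borel_measurable_continuous_onI matrix_vector_mult_linear_continuous_on)

lemma measurable_features:
  assumes "h \<in> {1..H}"
  shows "(\<lambda>w. B *v \<phi> (state_action h w) :: real ^ 's) \<in> paths \<rightarrow>\<^sub>M borel"
  using measurable_state_action[OF assms] by measurable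

lemma measurable_extend:
  assumes "n < H"
  shows "case_prod (extend U n) \<in> paths \<Otimes>\<^sub>M borel \<rightarrow>\<^sub>M paths"
proof -
  have [measurable]: "(\<lambda>w. U (Suc n) *v \<phi> (state_action (Suc n) w)) \<in> paths \<rightarrow>\<^sub>M borel"
    using assms by (intro measurable_features) auto
  show ?thesis
    unfolding extend_def case_prod_beta
    by (rule measurable_fun_upd[where J = UNIV]) auto
qed

lemma law_Suc:
  assumes "n < H"
  shows "law U (Suc n) = law U n \<bind> (\<lambda>w. distr (gaussian_noise \<sigma>) paths (extend U n w))"
proof -
  have "(\<lambda>s'. w(Suc (Suc n) := s')) \<in> borel \<rightarrow>\<^sub>M paths" for w :: "nat \<Rightarrow> real ^ 's"
    by (rule measurable_fun_upd[where J = UNIV]) (auto simp: space_PiM intro: measurable_const)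
  then show ?thesis
    by (simp add: law_def knr_mdp_def distr_distr comp_def extend_def[abs_def])
qed

lemma measurable_kernel:
  assumes "n < H"
  shows "(\<lambda>w. distr (gaussian_noise \<sigma>) paths (extend U n w)) \<in> paths \<rightarrow>\<^sub>M prob_algebra paths"
proof (rule measurable_prob_algebraI)
  interpret prob_space "gaussian_noise \<sigma> :: (real ^ 's) measure"
    using \<sigma> by (rule prob_space_gaussian_noise)
  have [measurable]: "extend U n w \<in> borel \<rightarrow>\<^sub>M paths" for w
    using measurable_Pair2[OF measurable_extend[OF assms], of w] by (simp add: space_PiM)
  show "prob_space (distr (gaussian_noise \<sigma>) paths (extend U n w))" for w
    by (rule prob_space_distr) simp
  have "gaussian_noise \<sigma> \<in> space (subprob_algebra (borel :: (real ^ 's) measure))"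
    by (simp add: space_subprob_algebra prob_space_imp_subprob_space prob_space_axioms)
  then show "(\<lambda>w. distr (gaussian_noise \<sigma>) paths (extend U n w)) \<in> paths \<rightarrow>\<^sub>M subprob_algebra paths"
    using measurable_extend[OF assms] by (intro measurable_distr2[where M = borel]) auto
qed

lemma law_in_prob_algebra:
  "n \<le> H \<Longrightarrow> law U n \<in> space (prob_algebra paths)"
proof (induction n)
  case 0
  then show ?case
    by (simp add: law_def space_prob_algebra prob_space_return space_PiM)
next
  case (Suc n)
  then have "n < H" and IH: "law U n \<in> space (prob_algebra paths)" by auto
  show ?case
    unfolding law_Suc[OF \<open>n < H\<close>]
    using prob_space_bind'[OF IH measurable_kernel[OF \<open>n < H\<close>]]
      sets_bind'[OF IH measurable_kernel[OF \<open>n < H\<close>]]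
    by (simp add: space_prob_algebra)
qed

lemma prob_space_law: "n \<le> H \<Longrightarrow> prob_space (law U n)"
  and sets_law: "n \<le> H \<Longrightarrow> sets (law U n) = sets paths"
  using law_in_prob_algebra[of n U] by (auto simp: space_prob_algebra)

lemma integral_law_Suc:
  fixes G :: "(nat \<Rightarrow> real ^ 's) \<Rightarrow> real"
  assumes "n < H" and [measurable]: "G \<in> borel_measurable paths" and G: "\<And>w. \<bar>G w\<bar> \<le> 1"
  shows "(\<integral>w. G w \<partial>law U (Suc n))
    = (\<integral>w. (\<integral>\<epsilon>. G (extend U n w \<epsilon>) \<partial>gaussian_noise \<sigma>) \<partial>law U n)"
proof -
  interpret prob_space "law U n" using assms(1) by (intro prob_space_law) simp
  have [measurable]: "extend U n w \<in> borel \<rightarrow>\<^sub>M paths" for w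
    using measurable_Pair2[OF measurable_extend[OF assms(1)], of w] by (simp add: space_PiM)
  have K: "(\<lambda>w. distr (gaussian_noise \<sigma>) paths (extend U n w)) \<in> law U n \<rightarrow>\<^sub>M subprob_algebra paths"
    using measurable_prob_algebraD[OF measurable_kernel[OF assms(1)]] sets_law[of n U] assms(1)
    by (simp cong: measurable_cong_sets)
  have "(\<integral>w. G w \<partial>law U (Suc n))
      = (\<integral>w. (\<integral>w'. G w' \<partial>distr (gaussian_noise \<sigma>) paths (extend U n w)) \<partial>law U n)"
    unfolding law_Suc[OF assms(1)]
  proof (rule integral_bind[OF assms(2) _ K])
    show "AE w in law U n. emeasure (distr (gaussian_noise \<sigma>) paths (extend U n w))
        (space (distr (gaussian_noise \<sigma>) paths (extend U n w))) \<le> ennreal 1"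
      using subprob_space.emeasure_space_le_1[OF subprob_space_kernel[OF K]] by (auto intro: AE_I2)
  qed (use G in \<open>auto intro: finite_measure_axioms\<close>)
  then show ?thesis
    by (simp add: integral_distr)
qed

lemma measurable_integral_extend:
  fixes G :: "(nat \<Rightarrow> real ^ 's) \<Rightarrow> real"
  assumes "n < H" and [measurable]: "G \<in> borel_measurable paths"
  shows "(\<lambda>w. \<integral>\<epsilon>. G (extend U n w \<epsilon>) \<partial>gaussian_noise \<sigma>) \<in> borel_measurable paths"
proof -
  interpret prob_space "gaussian_noise \<sigma> :: (real ^ 's) measure"
    using \<sigma> by (rule prob_space_gaussian_noise)
  have "(\<lambda>(w, \<epsilon>). G (extend U n w \<epsilon>)) \<in> borel_measurable (paths \<Otimes>\<^sub>M gaussian_noise \<sigma>)"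
    using measurable_compose[OF measurable_extend[OF assms(1), of U] assms(2)]
    by (simp add: case_prod_beta cong: measurable_cong_sets)
  then show ?thesis by (rule borel_measurable_lebesgue_integral)
qed

lemma integrable_features:
  fixes B :: "real ^ 'n ^ 's"
  assumes "h \<in> {1..H}" "n \<le> H"
  shows "integrable (law U n) (\<lambda>w. norm (B *v \<phi> (state_action h w)))"
proof -
  interpret prob_space "law U n" using assms(2) by (rule prob_space_law)
  show ?thesis
  proof (rule integrable_const_bound[of _ "onorm ((*v) B)"])
    have "norm (B *v \<phi> (state_action h w)) \<le> onorm ((*v) B)" for w
    proof -
      have "norm (B *v \<phi> (state_action h w)) \<le> onorm ((*v) B) * norm (\<phi> (state_action h w))"
        by (rule onorm) simp
      also have "\<dots> \<le> onorm ((*v) B)"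
        using norm_\<phi>[OF state_action_in[OF assms(1)]] onorm_pos_le[of "(*v) B"]
        by (intro mult_left_le) auto
      finally show ?thesis .
    qed
    then show "AE w in law U n. norm (norm (B *v \<phi> (state_action h w))) \<le> onorm ((*v) B)"
      by simp
    show "(\<lambda>w. norm (B *v \<phi> (state_action h w))) \<in> borel_measurable (law U n)"
      using measurable_features[OF assms(1)] sets_law[OF assms(2), of U]
      by (simp cong: measurable_cong_sets)
  qed
qed

text \<open>
  Integrating out the last transition turns a bounded functional of paths into another one, so that
  the two models can be exchanged one step at a time, starting from the last step.
\<close>

lemma simulation:
  fixes G :: "(nat \<Rightarrow> real ^ 's) \<Rightarrow> real"
  assumes "n \<le> H" "G \<in> borel_measurable paths" "\<And>w. 0 \<le> G w" "\<And>w. G w \<le> 1"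
  shows "(\<integral>w. G w \<partial>law U n) - (\<integral>w. G w \<partial>law U' n)
    \<le> 2 / \<sigma> * (\<Sum>i<n. \<integral>w. norm ((U (Suc i) - U' (Suc i)) *v \<phi> (state_action (Suc i) w)) \<partial>law U' i)"
  using assms
proof (induction n arbitrary: G)
  case 0
  show ?case by (simp add: law_def)
next
  case (Suc n)
  note [measurable] = Suc.prems(2)
  have n: "n < H" "n \<le> H" using Suc.prems by auto
  interpret g: prob_space "gaussian_noise \<sigma> :: (real ^ 's) measure"
    using \<sigma> by (rule prob_space_gaussian_noise)
  interpret L: prob_space "law U' n" using n(2) by (rule prob_space_law)
  define K where "K V w = (\<integral>\<epsilon>. G (extend V n w \<epsilon>) \<partial>gaussian_noise \<sigma>)" for V w
  define D where "D w = norm ((U (Suc n) - U' (Suc n)) *v \<phi> (state_action (Suc n) w))" for w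
  have ext [measurable]: "extend V n w \<in> borel \<rightarrow>\<^sub>M paths" for V w
    using measurable_Pair2[OF measurable_extend[OF n(1)], of w] by (simp add: space_PiM)
  have int: "integrable (gaussian_noise \<sigma>) (\<lambda>\<epsilon>. G (extend V n w \<epsilon>))" for V w
    using Suc.prems by (intro g.integrable_const_bound[of _ 1]) auto
  have K0: "0 \<le> K V w" for V w
    unfolding K_def using Suc.prems by (intro integral_nonneg_AE) auto
  have K1: "K V w \<le> 1" for V w
  proof -
    have "K V w \<le> (\<integral>\<epsilon>. 1 \<partial>(gaussian_noise \<sigma> :: (real ^ 's) measure))"
      unfolding K_def using Suc.prems by (intro integral_mono[OF int]) auto
    then show ?thesis using g.prob_space by simp
  qed
  have Km: "K V \<in> borel_measurable paths" for V
    unfolding K_def by (intro measurable_integral_extend n) simp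
  have Kint: "integrable (law U' n) (K V)" for V
  proof (rule L.integrable_const_bound[of _ 1])
    show "K V \<in> borel_measurable (law U' n)"
      using Km sets_law[OF n(2), of U'] by (simp cong: measurable_cong_sets)
  qed (use K0 K1 in auto)
  have Dint: "integrable (law U' n) D"
    unfolding D_def using n by (intro integrable_features) auto
  have diff: "K U w - K U' w \<le> 2 / \<sigma> * D w" for w
  proof -
    let ?F = "\<lambda>s'. G (w(Suc (Suc n) := s'))"
    have "(\<lambda>s'. w(Suc (Suc n) := s')) \<in> borel \<rightarrow>\<^sub>M paths"
        by (rule measurable_fun_upd[where J = UNIV]) (auto simp: space_PiM intro: measurable_const)
    then have "?F \<in> borel_measurable borel" by measurable
    from gaussian_noise_shift_diff[OF \<sigma> this Suc.prems(3,4),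
        of "U (Suc n) *v \<phi> (state_action (Suc n) w)" "U' (Suc n) *v \<phi> (state_action (Suc n) w)"]
    show ?thesis
      unfolding K_def D_def extend_def matrix_vector_mult_diff_rdistrib .
  qed
  have G1: "\<bar>G w\<bar> \<le> 1" for w using Suc.prems(3,4)[of w] by simp
  have step: "(\<integral>w. G w \<partial>law V (Suc n)) = (\<integral>w. K V w \<partial>law V n)" for V
    unfolding K_def using n(1) Suc.prems(2) G1 by (rule integral_law_Suc)
  have "(\<integral>w. G w \<partial>law U (Suc n)) - (\<integral>w. G w \<partial>law U' (Suc n))
      = ((\<integral>w. K U w \<partial>law U n) - (\<integral>w. K U w \<partial>law U' n)) + (\<integral>w. K U w - K U' w \<partial>law U' n)"
    unfolding step Bochner_Integration.integral_diff[OF Kint Kint] by linarith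
  also have "\<dots> \<le> 2 / \<sigma> * (\<Sum>i<n. \<integral>w. norm ((U (Suc i) - U' (Suc i)) *v \<phi> (state_action (Suc i) w)) \<partial>law U' i)
      + (\<integral>w. 2 / \<sigma> * D w \<partial>law U' n)"
  proof (rule add_mono)
    show "(\<integral>w. K U w - K U' w \<partial>law U' n) \<le> (\<integral>w. 2 / \<sigma> * D w \<partial>law U' n)"
      by (rule integral_mono[OF Bochner_Integration.integrable_diff[OF Kint Kint]
            integrable_mult_right[OF Dint] diff])
  qed (rule Suc.IH[OF n(2) Km K0 K1])
  finally show ?case
    unfolding sum.lessThan_Suc distrib_left integral_mult_right_zero D_def .
qed

lemma policy_value_model:
  "policy_value (model U) \<pi> 1 s\<^sub>1 = (\<integral>w. (\<Sum>j=1..H. r j (state_action j w)) \<partial>law U (H - 1))"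
  by (simp add: law_def policy_value_def knr_mdp_def)

lemma integral_occupancy:
  fixes B :: "real ^ 'n ^ 's"
  assumes "h \<in> {1..H}"
  shows "(\<integral>\<eta>. norm (B *v \<phi> \<eta>) \<partial>occupancy (model U) \<pi> h)
    = (\<integral>w. norm (B *v \<phi> (state_action h w)) \<partial>law U (h - 1))"
proof -
  have "h - 1 \<le> H" using assms by auto
  have [simp]: "actions (model U) = A" "initial_state (model U) = s\<^sub>1" by (simp_all add: knr_mdp_def)
  have [measurable]: "state_action h \<in> law U (h - 1) \<rightarrow>\<^sub>M borel \<Otimes>\<^sub>M A"
    using measurable_state_action[OF assms] sets_law[OF \<open>h - 1 \<le> H\<close>, of U]
    by (simp cong: measurable_cong_sets)
  then show ?thesis
    unfolding occupancy_def by (subst integral_distr) (simp_all add: law_def)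
qed

lemma policy_value_diff_le:
  assumes "H \<ge> 1" and r: "\<And>h. h \<in> {1..H} \<Longrightarrow> r h \<in> borel \<Otimes>\<^sub>M A \<rightarrow>\<^sub>M borel"
    and unit: "unit_total_reward (model U')"
  shows "policy_value (model U) \<pi> 1 s\<^sub>1 - policy_value (model U') \<pi> 1 s\<^sub>1
    \<le> 2 * real H / \<sigma> * (\<Sum>h=1..H. \<integral>\<eta>. norm ((U h - U' h) *v \<phi> \<eta>) \<partial>occupancy (model U') \<pi> h)"
proof -
  define G where "G w = (\<Sum>j=1..H. r j (state_action j w))" for w
  define E where "E h = (\<integral>\<eta>. norm ((U h - U' h) *v \<phi> \<eta>) \<partial>occupancy (model U') \<pi> h)" for h
  have G: "G w \<in> {0..1}" for w
    using unit state_action_in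
    unfolding unit_total_reward_def G_def state_actions_def knr_mdp_def by simp
  have "G \<in> borel_measurable paths"
    unfolding G_def using measurable_compose[OF measurable_state_action r]
    by (intro borel_measurable_sum) auto
  then have "policy_value (model U) \<pi> 1 s\<^sub>1 - policy_value (model U') \<pi> 1 s\<^sub>1
    \<le> 2 / \<sigma> * (\<Sum>i<H - 1. \<integral>w. norm ((U (Suc i) - U' (Suc i)) *v \<phi> (state_action (Suc i) w)) \<partial>law U' i)"
    unfolding policy_value_model G_def[symmetric] using G by (intro simulation) auto
  also have "\<dots> = 2 / \<sigma> * (\<Sum>i<H - 1. E (Suc i))"
    by (simp add: E_def integral_occupancy)
  also have "\<dots> \<le> 2 / \<sigma> * (\<Sum>i<H. E (Suc i))"
    using \<sigma> by (intro mult_left_mono sum_mono2) (auto simp: E_def)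
  also have "(\<Sum>i<H. E (Suc i)) = (\<Sum>h=1..H. E h)"
    by (simp add: sum.atLeast1_atMost_eq)
  also have "2 / \<sigma> * \<dots> \<le> 2 * real H / \<sigma> * \<dots>"
    using \<sigma> \<open>H \<ge> 1\<close> by (intro mult_right_mono divide_right_mono sum_nonneg) (auto simp: E_def)
  finally show ?thesis by (simp add: E_def)
qed

end

lemma expected_loss_knr:
  fixes U :: "nat \<Rightarrow> real ^ 'n ^ 's"
  assumes "\<sigma> > 0"
  shows "expected_loss (knr_mdp H A s\<^sub>1 r \<phi> \<sigma> U) (knr_loss \<phi>) h f' \<eta> f g = (g h - U h) *v \<phi> \<eta>"
proof -
  interpret prob_space "gaussian_noise \<sigma> :: (real ^ 's) measure"
    using assms by (rule prob_space_gaussian_noise)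
  have "expected_loss (knr_mdp H A s\<^sub>1 r \<phi> \<sigma> U) (knr_loss \<phi>) h f' \<eta> f g
      = (\<integral>\<epsilon>. ((g h - U h) *v \<phi> \<eta>) - \<epsilon> \<partial>gaussian_noise \<sigma>)"
    by (simp add: expected_loss_def knr_mdp_def knr_loss_def integral_distr
        matrix_vector_mult_diff_rdistrib diff_diff_eq)
  also have "\<dots> = (g h - U h) *v \<phi> \<eta>"
    using integrable_gaussian_noise_id[OF assms] prob_space[simplified]
    by (subst Bochner_Integration.integral_diff) (simp_all add: integral_gaussian_noise_id)
  finally show ?thesis .
qed

lemma norm_mult_vec_le_spectral_norm: "norm (U *v x) \<le> spectral_norm U * norm x"
  unfolding spectral_norm_def by (rule onorm) simp

lemma norm_diff_mult_vec_le:
  fixes U V :: "real ^ 'n ^ 's"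
  assumes "spectral_norm U \<le> R" "spectral_norm V \<le> R"
  shows "norm ((U - V) *v x) \<le> 2 * R * norm x"
proof -
  have "norm ((U - V) *v x) \<le> norm (U *v x) + norm (V *v x)"
    unfolding matrix_vector_mult_diff_rdistrib by (rule norm_triangle_ineq4)
  also have "\<dots> \<le> R * norm x + R * norm x"
    using norm_mult_vec_le_spectral_norm[of U x] norm_mult_vec_le_spectral_norm[of V x]
      mult_right_mono[OF assms(1) norm_ge_zero[of x]] mult_right_mono[OF assms(2) norm_ge_zero[of x]]
    by linarith
  finally show ?thesis by simp
qed

lemma bounded_whp_knr:
  fixes U :: "nat \<Rightarrow> real ^ 'n ^ 's"
  assumes "\<sigma> > 0" and \<phi>: "\<forall>\<eta>\<in>UNIV \<times> space A. norm (\<phi> \<eta>) \<le> 1"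
    and U: "\<forall>h\<in>{1..H}. spectral_norm (U h) \<le> R"
  shows "bounded_whp (knr_mdp H A s\<^sub>1 r \<phi> \<sigma> U) F (knr_hypotheses H R) (knr_loss \<phi>)
    (\<lambda>\<delta>. 2 * R + \<sigma> * sqrt (2 * real CARD('s) * ln (2 * real CARD('s) / \<delta>)))"
  unfolding bounded_whp_def
proof (intro ballI)
  fix \<delta> h f' f \<eta> and g :: "nat \<Rightarrow> real ^ 'n ^ 's"
  assume \<delta>: "\<delta> \<in> {0<..<1::real}" and "h \<in> {1..horizon (knr_mdp H A s\<^sub>1 r \<phi> \<sigma> U)}"
    and g: "g \<in> knr_hypotheses H R" and "\<eta> \<in> state_actions (knr_mdp H A s\<^sub>1 r \<phi> \<sigma> U)"
  then have h: "h \<in> {1..H}" and \<eta>: "\<eta> \<in> UNIV \<times> space A"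
    by (auto simp: knr_mdp_def state_actions_def)
  interpret prob_space "gaussian_noise \<sigma> :: (real ^ 's) measure"
    using assms(1) by (rule prob_space_gaussian_noise)
  let ?T = "transition (knr_mdp H A s\<^sub>1 r \<phi> \<sigma> U) h \<eta>"
  let ?t = "\<sigma> * sqrt (2 * real CARD('s) * ln (2 * real CARD('s) / \<delta>))"
  let ?c = "(g h - U h) *v \<phi> \<eta>"
  have "0 \<le> spectral_norm (U h)"
    unfolding spectral_norm_def by (rule onorm_pos_le) simp
  also have "\<dots> \<le> R" using U h by blast
  finally have "R \<ge> 0" .
  have "norm ?c \<le> 2 * R * norm (\<phi> \<eta>)"
    using U g h by (intro norm_diff_mult_vec_le) (auto simp: knr_hypotheses_def)
  also have "\<dots> \<le> 2 * R"
    using \<phi> \<eta> \<open>R \<ge> 0\<close> by (intro mult_left_le) auto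
  finally have c: "norm ?c \<le> 2 * R" .
  have "1 - \<delta> \<le> prob {\<epsilon>. norm \<epsilon> \<le> ?t}"
    using \<delta> assms(1) by (intro gaussian_noise_norm_tail) auto
  also have "\<dots> \<le> prob {\<epsilon>. norm (?c - \<epsilon>) \<le> 2 * R + ?t}"
  proof (rule finite_measure_mono)
    have "norm (?c - \<epsilon>) \<le> 2 * R + ?t" if "norm \<epsilon> \<le> ?t" for \<epsilon>
      using norm_triangle_ineq4[of ?c \<epsilon>] add_mono[OF c that] by (rule order_trans)
    then show "{\<epsilon>. norm \<epsilon> \<le> ?t} \<subseteq> {\<epsilon>. norm (?c - \<epsilon>) \<le> 2 * R + ?t}"
      by (rule Collect_mono[OF impI])
  qed measurable
  also have "\<dots> = measure ?T {\<zeta> \<in> space ?T. norm (knr_loss \<phi> h f' \<zeta> \<eta> f g) \<le> 2 * R + ?t}"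
    by (simp add: knr_mdp_def knr_loss_def measure_distr matrix_vector_mult_diff_rdistrib diff_diff_eq)
  finally show "1 - \<delta> \<le> measure ?T {\<zeta> \<in> space ?T. norm (knr_loss \<phi> h f' \<zeta> \<eta> f g) \<le> 2 * R + ?t}" .
qed

section \<open>The EC class\<close>

theorem lemmaD5:
  fixes H :: nat
    and A :: "'a measure"
    and s\<^sub>1 :: "real ^ 's"
    and r :: "nat \<Rightarrow> (real ^ 's) \<times> 'a \<Rightarrow> real"
    and \<phi> :: "(real ^ 's) \<times> 'a \<Rightarrow> real ^ 'n"
    and \<sigma> R :: real
    and Ustar :: "nat \<Rightarrow> real ^ 'n ^ 's"
    and \<pi> :: "(nat \<Rightarrow> real ^ 'n ^ 's) \<Rightarrow> (real ^ 's, 'a) policy"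
  assumes "H \<ge> 1"
    and "\<sigma> > 0"
    and "\<phi> \<in> borel \<Otimes>\<^sub>M A \<rightarrow>\<^sub>M borel"
    and "\<forall>\<eta>\<in>UNIV \<times> space A. norm (\<phi> \<eta>) \<le> 1"
    and "\<forall>h\<in>{1..H}. r h \<in> borel \<Otimes>\<^sub>M A \<rightarrow>\<^sub>M borel"
    and "unit_total_reward (knr_mdp H A s\<^sub>1 r \<phi> \<sigma> Ustar)"
    and "\<forall>h\<in>{1..H}. spectral_norm (Ustar h) \<le> R"
    and "\<forall>f\<in>knr_hypotheses H R. optimal_policy (knr_mdp H A s\<^sub>1 r \<phi> \<sigma> f) (\<pi> f)"
  shows "l2_type_EC_class
           20 (R\<^sup>2)
           (\<lambda>\<delta>. 2 * R + \<sigma> * sqrt (2 * real CARD('s) * ln (2 * real CARD('s) / \<delta>)))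
           (\<lambda>f. optimal_value (knr_mdp H A s\<^sub>1 r \<phi> \<sigma> f)) \<pi> Ustar
           (knr_mdp H A s\<^sub>1 r \<phi> \<sigma> Ustar) (knr_hypotheses H R) (knr_hypotheses H R) (knr_loss \<phi>)
           (real CARD('n)) (2 * real H / \<sigma>)
         \<and> (\<forall>h\<in>{1..H}. \<forall>\<beta>\<ge>R\<^sup>2. \<forall>K\<ge>2. \<forall>f \<eta>.
              (\<forall>i\<in>{1..K}. f i \<in> knr_hypotheses H R) \<longrightarrow>
              (\<forall>i\<in>{1..K}. \<eta> i \<in> UNIV \<times> space A) \<longrightarrow>
              (\<forall>k\<in>{1..K}. (\<Sum>i\<in>{1..<k}. (norm ((f k h - Ustar h) *v \<phi> (\<eta> i)))\<^sup>2) \<le> \<beta>) \<longrightarrow>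
              (\<forall>k\<in>{1..K}. (\<Sum>i\<in>{1..k}. (norm ((f i h - Ustar h) *v \<phi> (\<eta> i)))\<^sup>2)
                 \<le> 20 * (real CARD('n) * \<beta> * ln (real K))))"
proof -
  let ?M = "\<lambda>f. knr_mdp H A s\<^sub>1 r \<phi> \<sigma> f"
  note \<sigma> = assms(2) and \<phi> = assms(4) and Ustar = assms(7) and opt = assms(8)
  have Ustar_in: "Ustar \<in> knr_hypotheses H R"
    using Ustar by (simp add: knr_hypotheses_def)
  have horizon: "horizon (?M f) = H" and actions: "actions (?M f) = A"
    and initial: "initial_state (?M f) = s\<^sub>1" for f
    by (simp_all add: knr_mdp_def)
  have eluder: "(\<Sum>i\<in>{1..k}. (norm ((f i h - Ustar h) *v \<phi> (\<eta> i)))\<^sup>2)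
      \<le> 20 * (real CARD('n) * \<beta> * ln (real K))"
    if h: "h \<in> {1..H}" and "\<beta> \<ge> R\<^sup>2" "K \<ge> 2" and f: "\<forall>i\<in>{1..K}. f i \<in> knr_hypotheses H R"
      and \<eta>: "\<forall>i\<in>{1..K}. \<eta> i \<in> UNIV \<times> space A" and k: "k \<in> {1..K}"
      and \<beta>: "\<forall>k\<in>{1..K}. (\<Sum>i\<in>{1..<k}. (norm ((f k h - Ustar h) *v \<phi> (\<eta> i)))\<^sup>2) \<le> \<beta>"
    for h \<beta> K f \<eta> k
  proof (rule eluder_bound[where x = "\<lambda>i. \<phi> (\<eta> i)" and D = "\<lambda>i. f i h - Ustar h" and R = R])
    show "norm (\<phi> (\<eta> i)) \<le> 1" if "i \<in> {1..K}" for i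
      using \<phi> \<eta> that by blast
    show "norm ((f i h - Ustar h) *v v) \<le> 2 * R * norm v" if "i \<in> {1..K}" for i v
      using f that h Ustar by (intro norm_diff_mult_vec_le) (auto simp: knr_hypotheses_def)
    show "(\<Sum>i\<in>{1..<k}. (norm ((f k h - Ustar h) *v \<phi> (\<eta> i)))\<^sup>2) \<le> \<beta>" if "k \<in> {1..K}" for k
      using \<beta> that by blast
  qed fact+
  have value_gap: "optimal_value (?M f) 1 s\<^sub>1 - policy_value (?M Ustar) (\<pi> f) 1 s\<^sub>1
      \<le> 2 * real H / \<sigma> * (\<Sum>h=1..H. \<integral>\<eta>. norm ((f h - Ustar h) *v \<phi> \<eta>) \<partial>occupancy (?M Ustar) (\<pi> f) h)"
    if f: "f \<in> knr_hypotheses H R" for f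
  proof -
    from opt f have "optimal_policy (?M f) (\<pi> f)" by blast
    then have "\<pi> f \<in> policies (?M f)"
      and *: "policy_value (?M f) (\<pi> f) 1 s\<^sub>1 = optimal_value (?M f) 1 s\<^sub>1"
      using \<open>H \<ge> 1\<close> unfolding optimal_policy_def horizon by auto
    then interpret knr H A s\<^sub>1 r \<phi> \<sigma> "\<pi> f"
      using assms(2-4) by unfold_locales (auto simp: policies_def horizon actions)
    show ?thesis
      unfolding *[symmetric] using assms(1,5,6) by (intro policy_value_diff_le) auto
  qed
  have "dominance (?M Ustar) (knr_hypotheses H R) (\<lambda>f. optimal_value (?M f)) \<pi> (knr_loss \<phi>)
      (2 * real H / \<sigma>)"
    unfolding dominance_def
  proof (intro allI impI ballI)
    fix K :: nat and P :: "(nat \<Rightarrow> nat \<Rightarrow> real ^ 'n ^ 's) measure" and k and \<delta> :: real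
    assume "prob_space P" and P: "\<forall>f\<in>space P. \<forall>i\<in>{1..K}. f i \<in> knr_hypotheses H R"
      and k: "k \<in> {1..K}" and \<delta>: "\<delta> \<in> {0<..<1}"
    interpret P: prob_space P by fact
    let ?e = "\<lambda>f h. \<integral>\<eta>. norm (expected_loss (?M Ustar) (knr_loss \<phi>) h f \<eta> f f)
      \<partial>occupancy (?M Ustar) (\<pi> f) h"
    have "(\<Sum>i=1..k. optimal_value (?M (f i)) 1 s\<^sub>1 - policy_value (?M Ustar) (\<pi> (f i)) 1 s\<^sub>1)
        \<le> 2 * real H / \<sigma> * (\<Sum>h=1..H. \<Sum>i=1..k. ?e (f i) h)" if "f \<in> space P" for f
    proof -
      have "(\<Sum>i=1..k. optimal_value (?M (f i)) 1 s\<^sub>1 - policy_value (?M Ustar) (\<pi> (f i)) 1 s\<^sub>1)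
          \<le> (\<Sum>i=1..k. 2 * real H / \<sigma> * (\<Sum>h=1..H. ?e (f i) h))"
      proof (rule sum_mono)
        fix i assume "i \<in> {1..k}"
        then have "f i \<in> knr_hypotheses H R" using P that k by auto
        then show "optimal_value (?M (f i)) 1 s\<^sub>1 - policy_value (?M Ustar) (\<pi> (f i)) 1 s\<^sub>1
            \<le> 2 * real H / \<sigma> * (\<Sum>h=1..H. ?e (f i) h)"
          unfolding expected_loss_knr[OF \<sigma>] by (rule value_gap)
      qed
      also have "\<dots> = 2 * real H / \<sigma> * (\<Sum>h=1..H. \<Sum>i=1..k. ?e (f i) h)"
        unfolding sum_distrib_left[symmetric] by (subst sum.swap) (rule refl)
      finally show ?thesis .
    qed
    then show "\<exists>E\<in>sets P. 1 - \<delta> \<le> measure P E \<and> (\<forall>f\<in>E.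
        (\<Sum>i=1..k. optimal_value (?M (f i)) 1 (initial_state (?M Ustar))
          - policy_value (?M Ustar) (\<pi> (f i)) 1 (initial_state (?M Ustar)))
        \<le> 2 * real H / \<sigma> * (\<Sum>h=1..horizon (?M Ustar). \<Sum>i=1..k. ?e (f i) h))"
      using \<delta> unfolding horizon initial
      by (intro bexI[of _ "space P"]) (auto simp: P.prob_space)
  qed
  moreover have "eluder_condition 20 (R\<^sup>2) (?M Ustar) (knr_hypotheses H R) (knr_loss \<phi>) (real CARD('n))"
    unfolding eluder_condition_def expected_loss_knr[OF \<sigma>] horizon state_actions_def actions
    by (intro allI impI ballI) (rule eluder)
  moreover have "bounded_whp (?M Ustar) (knr_hypotheses H R) (knr_hypotheses H R) (knr_loss \<phi>)
      (\<lambda>\<delta>. 2 * R + \<sigma> * sqrt (2 * real CARD('s) * ln (2 * real CARD('s) / \<delta>)))"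
    by (rule bounded_whp_knr) fact+
  moreover have "true_hypothesis (?M Ustar) (\<lambda>f. optimal_value (?M f)) \<pi> Ustar"
    using opt Ustar_in by (simp add: true_hypothesis_def)
  ultimately have "l2_type_EC_class 20 (R\<^sup>2)
      (\<lambda>\<delta>. 2 * R + \<sigma> * sqrt (2 * real CARD('s) * ln (2 * real CARD('s) / \<delta>)))
      (\<lambda>f. optimal_value (?M f)) \<pi> Ustar (?M Ustar) (knr_hypotheses H R) (knr_hypotheses H R)
      (knr_loss \<phi>) (real CARD('n)) (2 * real H / \<sigma>)"
    using Ustar_in by (simp add: l2_type_EC_class_def)
  moreover note eluder
  ultimately show ?thesis by blast
qed

end
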